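(* Let $K$ be an algebraically closed field, let $n\geq 5$, and let $d\geq 1$ be an integer with $d\leq 2\left\lfloor\frac{n-1}{4}\right\rfloor-1$. Then there are only finitely many conjugacy classes of irreducible representations $$\rho:\mathrm{SAut}(F_n)\rightarrow \mathrm{SL}_d(K).$$
   Context: $F_n$ is the free group of rank $n$. The abelianization $F_n\to\mathbb{Z}^n$ induces an epimorphism $\mathrm{Aut}(F_n)\to\mathrm{GL}_n(\mathbb{Z})$, and $\mathrm{SAut}(F_n)$ is the preimage of $\mathrm{SL}_n(\mathbb{Z})$ under this map. A representation $\rho:G\to\mathrm{SL}_d(K)$ is irreducible if $K^d$ has no $\rho(G)$-invariant linear subspaces other than $0$ and $K^d$; two representations are conjugate if they differ by conjugation by an element of $\mathrm{GL}_d(K)$ (equivalently, since $K$ is algebraically closed, by an element of $\mathrm{SL}_d(K)$). *)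

theory Defs
  imports
    "HOL-Algebra.Bij"
    "HOL-Computational_Algebra.Polynomial"
    "Jordan_Normal_Form.Determinant"
    "Jordan_Normal_Form.VS_Connect"
begin

section \<open>The free group of rank n\<close>

text \<open>A letter \<open>(i, True)\<close> stands for the generator \<open>x\<^sub>i\<close>, and \<open>(i, False)\<close> for its inverse.
  The elements of the free group are the freely reduced words.\<close>

type_synonym letter = "nat \<times> bool"

definition inv_letter :: "letter \<Rightarrow> letter" where
  "inv_letter x = (fst x, \<not> snd x)"

definition reduced :: "letter list \<Rightarrow> bool" where
  "reduced w \<longleftrightarrow> successively (\<lambda>x y. y \<noteq> inv_letter x) w"

fun cons_red :: "letter \<Rightarrow> letter list \<Rightarrow> letter list" where
  "cons_red x [] = [x]"
| "cons_red x (y # ys) = (if y = inv_letter x then ys else x # y # ys)"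

definition free_group :: "nat \<Rightarrow> letter list monoid" where
  "free_group n =
    \<lparr>carrier = {w. reduced w \<and> fst ` set w \<subseteq> {..<n}},
     mult = foldr cons_red,
     one = []\<rparr>"

definition gen :: "nat \<Rightarrow> letter list" where
  "gen i = [(i, True)]"

lemma inv_letter_inv_letter [simp]: "inv_letter (inv_letter x) = x"
  by (simp add: inv_letter_def)

lemma fst_inv_letter [simp]: "fst (inv_letter x) = fst x"
  by (simp add: inv_letter_def)

lemma reduced_Nil [simp]: "reduced []"
  by (simp add: reduced_def)

lemma reduced_single [simp]: "reduced [x]"
  by (simp add: reduced_def)

lemma reduced_Cons_Cons [simp]:
  "reduced (x # y # ys) \<longleftrightarrow> y \<noteq> inv_letter x \<and> reduced (y # ys)"
  by (simp add: reduced_def)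

lemma reduced_ConsD: "reduced (x # xs) \<Longrightarrow> reduced xs"
  by (cases xs) auto

lemma reduced_cons_red: "reduced w \<Longrightarrow> reduced (cons_red x w)"
  by (cases w) (auto dest: reduced_ConsD)

lemma cons_red_cancel: "reduced w \<Longrightarrow> cons_red x (cons_red (inv_letter x) w) = w"
proof (cases w)
  case (Cons y ys)
  then show "reduced w \<Longrightarrow> cons_red x (cons_red (inv_letter x) w) = w"
    by (cases ys) auto
qed simp

lemma cons_red_reduced: "reduced (x # w) \<Longrightarrow> cons_red x w = x # w"
  by (cases w) auto

lemma reduced_foldr: "reduced v \<Longrightarrow> reduced (foldr cons_red u v)"
  by (induction u) (auto intro: reduced_cons_red)

lemma set_cons_red: "set (cons_red x w) \<subseteq> insert x (set w)"
  by (cases w) auto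

lemma set_foldr_cons_red: "set (foldr cons_red u v) \<subseteq> set u \<union> set v"
  using set_cons_red by (induction u) fastforce+

lemma foldr_cons_red_cons_red:
  assumes "reduced w"
  shows "foldr cons_red (cons_red x u) w = cons_red x (foldr cons_red u w)"
proof (cases u)
  case (Cons y ys)
  show ?thesis
    using cons_red_cancel[OF reduced_foldr[OF assms], of x ys] Cons by auto
qed simp

lemma foldr_cons_red_assoc:
  "reduced w \<Longrightarrow> foldr cons_red (foldr cons_red u v) w = foldr cons_red u (foldr cons_red v w)"
  by (induction u) (auto simp: foldr_cons_red_cons_red)

lemma foldr_cons_red_Nil: "reduced u \<Longrightarrow> foldr cons_red u [] = u"
proof (induction u)
  case (Cons x u)
  then show ?case using reduced_ConsD[OF Cons.prems] by (simp add: cons_red_reduced)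
qed simp

lemma foldr_inverse:
  "reduced w \<Longrightarrow> foldr cons_red (rev (map inv_letter u)) (foldr cons_red u w) = w"
proof (induction u)
  case (Cons x u)
  then show ?case
    using cons_red_cancel[OF reduced_foldr[OF Cons.prems], of "inv_letter x" u] by simp
qed simp

theorem group_free_group: "group (free_group n)"
proof (rule groupI)
  fix x y assume "x \<in> carrier (free_group n)" "y \<in> carrier (free_group n)"
  then show "x \<otimes>\<^bsub>free_group n\<^esub> y \<in> carrier (free_group n)"
    using set_foldr_cons_red[of x y] by (fastforce simp: free_group_def intro: reduced_foldr)
next
  fix x assume x: "x \<in> carrier (free_group n)"
  let ?v = "rev (map inv_letter x)"
  let ?y = "foldr cons_red ?v []"
  have "fst ` set ?y \<subseteq> {..<n}"
  proof -
    have "fst ` set ?y \<subseteq> fst ` set ?v"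
      using set_foldr_cons_red[of ?v "[]"] by (intro image_mono) simp
    also have "fst ` set ?v = fst ` set x"
      by (simp add: image_image)
    finally show ?thesis using x by (auto simp: free_group_def)
  qed
  moreover have "foldr cons_red ?y x = []"
  proof -
    have "foldr cons_red ?y x = foldr cons_red ?v (foldr cons_red x [])"
      using x by (simp add: foldr_cons_red_assoc foldr_cons_red_Nil free_group_def)
    then show ?thesis by (simp only: foldr_inverse reduced_Nil)
  qed
  ultimately show "\<exists>y\<in>carrier (free_group n). y \<otimes>\<^bsub>free_group n\<^esub> x = \<one>\<^bsub>free_group n\<^esub>"
    by (intro bexI[of _ ?y]) (auto simp: free_group_def intro: reduced_foldr)
qed (auto simp: free_group_def foldr_cons_red_assoc)

lemma gen_carrier: "i < n \<Longrightarrow> gen i \<in> carrier (free_group n)"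
  by (simp add: gen_def free_group_def)

lemma inv_gen:
  assumes "i < n"
  shows "inv\<^bsub>free_group n\<^esub> (gen i) = [(i, False)]"
  using assms
  by (intro group.inv_equality[OF group_free_group])
     (auto simp: free_group_def gen_def inv_letter_def)

text \<open>The universal property of the free group on \<open>x\<^sub>0, \<dots>, x\<^bsub>n-1\<^esub>\<close>.\<close>

theorem free_group_universal:
  assumes G: "group G" and f: "f \<in> {..<n} \<rightarrow> carrier G"
  shows "\<exists>!h. h \<in> hom (free_group n) G \<inter> extensional (carrier (free_group n)) \<and>
              (\<forall>i<n. h (gen i) = f i)"
proof -
  interpret G: group G by fact
  let ?F = "free_group n"
  define e where "e x = (if snd x then f (fst x) else inv\<^bsub>G\<^esub> (f (fst x)))" for x :: letter
  define h where "h w = foldr (\<lambda>x g. e x \<otimes>\<^bsub>G\<^esub> g) w \<one>\<^bsub>G\<^esub>" for w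
  have e: "e x \<in> carrier G" if "fst x < n" for x
    using f that by (auto simp: e_def)
  have e_inv: "e x \<otimes>\<^bsub>G\<^esub> e (inv_letter x) = \<one>\<^bsub>G\<^esub>" if "fst x < n" for x
    using f that by (auto simp: e_def inv_letter_def Pi_iff)
  have hc: "h w \<in> carrier G" if "fst ` set w \<subseteq> {..<n}" for w
    using that e by (induction w) (auto simp: h_def)
  have h_cons: "h (cons_red x w) = e x \<otimes>\<^bsub>G\<^esub> h w"
    if x: "fst x < n" and w: "fst ` set w \<subseteq> {..<n}" for x w
  proof (cases w)
    case (Cons y ys)
    have "h ys = e x \<otimes>\<^bsub>G\<^esub> (e (inv_letter x) \<otimes>\<^bsub>G\<^esub> h ys)"
      using e[of x] e[of "inv_letter x"] e_inv[of x] hc[of ys] x w Cons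
      by (simp add: G.m_assoc[symmetric])
    then show ?thesis using Cons by (auto simp: h_def)
  qed (simp add: h_def)
  have h_mult: "h (foldr cons_red u w) = h u \<otimes>\<^bsub>G\<^esub> h w"
    if "fst ` set u \<subseteq> {..<n}" "fst ` set w \<subseteq> {..<n}" for u w
    using that
  proof (induction u)
    case Nil
    then show ?case using hc[of w] by (simp add: h_def)
  next
    case (Cons x u)
    have "fst ` set (foldr cons_red u w) \<subseteq> {..<n}"
      using set_foldr_cons_red[of u w] Cons.prems by fastforce
    then have "h (foldr cons_red (x # u) w) = e x \<otimes>\<^bsub>G\<^esub> (h u \<otimes>\<^bsub>G\<^esub> h w)"
      using Cons h_cons[of x "foldr cons_red u w"] by simp
    also have "\<dots> = h (x # u) \<otimes>\<^bsub>G\<^esub> h w"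
      using Cons.prems e[of x] hc[of u] hc[of w] by (simp add: G.m_assoc h_def)
    finally show ?case .
  qed
  show ?thesis
  proof (rule ex1I)
    let ?h = "restrict h (carrier ?F)"
    have "?h \<in> hom ?F G"
    proof (rule homI)
      fix u w assume uw: "u \<in> carrier ?F" "w \<in> carrier ?F"
      then have "u \<otimes>\<^bsub>?F\<^esub> w \<in> carrier ?F"
        using group_free_group[of n] by (simp add: group.is_monoid monoid.m_closed)
      then show "?h (u \<otimes>\<^bsub>?F\<^esub> w) = ?h u \<otimes>\<^bsub>G\<^esub> ?h w"
        using uw h_mult[of u w] by (auto simp: free_group_def)
    qed (use hc in \<open>auto simp: free_group_def\<close>)
    moreover have "?h (gen i) = f i" if "i < n" for i
      using that f gen_carrier[OF that] by (auto simp: h_def e_def gen_def Pi_iff)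
    ultimately show "?h \<in> hom ?F G \<inter> extensional (carrier ?F) \<and> (\<forall>i<n. ?h (gen i) = f i)"
      by auto
  next
    fix k
    assume k: "k \<in> hom ?F G \<inter> extensional (carrier ?F) \<and> (\<forall>i<n. k (gen i) = f i)"
    interpret k: group_hom ?F G k
      using k G group_free_group by (auto simp: group_hom_def group_hom_axioms_def)
    have k_letter: "k [x] = e x" if "fst x < n" for x
    proof (cases "snd x")
      case True
      then have "[x] = gen (fst x)" by (metis gen_def prod.collapse)
      with True k that show ?thesis by (simp add: e_def)
    next
      case False
      then have "[x] = inv\<^bsub>?F\<^esub> gen (fst x)" by (metis inv_gen that prod.collapse)
      with False k that show ?thesis by (simp add: e_def gen_carrier)
    qed
    have "k w = h w" if "w \<in> carrier ?F" for w
      using that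
    proof (induction w)
      case Nil
      then show ?case using k.hom_one by (simp add: free_group_def h_def)
    next
      case (Cons x w)
      then have x: "[x] \<in> carrier ?F" and w: "w \<in> carrier ?F" and "fst x < n"
        by (auto simp: free_group_def dest: reduced_ConsD)
      have "x # w = [x] \<otimes>\<^bsub>?F\<^esub> w"
        using Cons.prems by (simp add: free_group_def cons_red_reduced)
      then have "k (x # w) = e x \<otimes>\<^bsub>G\<^esub> h w"
        using k.hom_mult[OF x w] k_letter[OF \<open>fst x < n\<close>] Cons.IH[OF w] by simp
      then show ?case by (simp add: h_def)
    qed
    then show "k = restrict h (carrier ?F)"
      using k by (intro extensionalityI[of _ "carrier ?F"]) auto
  qed
qed

section \<open>The special linear group and the group SAut(\<open>F\<^sub>n\<close>)\<close>

definition SL :: "nat \<Rightarrow> 'a::comm_ring_1 mat monoid" where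
  "SL d = \<lparr>carrier = {A \<in> carrier_mat d d. det A = 1}, mult = (*), one = 1\<^sub>m d\<rparr>"

text \<open>The abelianization \<open>F\<^sub>n \<rightarrow> \<int>\<^sup>n\<close> is the vector of exponent sums of the generators.\<close>

definition exponent_sum :: "letter list \<Rightarrow> nat \<Rightarrow> int" where
  "exponent_sum w i = (\<Sum>(j, b)\<leftarrow>w. if j = i then (if b then 1 else - 1) else 0)"

definition abelianization :: "nat \<Rightarrow> letter list \<Rightarrow> int vec" where
  "abelianization n w = vec n (exponent_sum w)"

text \<open>The matrix of the endomorphism of \<open>\<int>\<^sup>n\<close> induced by \<open>\<phi>\<close>: column \<open>j\<close> is the image of the
  \<open>j\<close>-th standard basis vector, which is the abelianization of \<open>x\<^sub>j\<close>.\<close>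

definition induced_mat :: "nat \<Rightarrow> (letter list \<Rightarrow> letter list) \<Rightarrow> int mat" where
  "induced_mat n \<phi> = mat_of_cols n (map (\<lambda>j. abelianization n (\<phi> (gen j))) [0..<n])"

definition SAut :: "nat \<Rightarrow> (letter list \<Rightarrow> letter list) monoid" where
  "SAut n = AutoGroup (free_group n)
    \<lparr>carrier := {\<phi> \<in> carrier (AutoGroup (free_group n)). induced_mat n \<phi> \<in> carrier (SL n)}\<rparr>"

lemma exponent_sum_cons_red: "exponent_sum (cons_red x w) i = exponent_sum [x] i + exponent_sum w i"
  by (cases w) (auto simp: exponent_sum_def inv_letter_def split: prod.splits)

lemma abelianization_mult:
  "abelianization n (u \<otimes>\<^bsub>free_group n\<^esub> v) = abelianization n u + abelianization n v"
proof -
  have "exponent_sum (foldr cons_red u v) i = exponent_sum u i + exponent_sum v i" for i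
  proof (induction u)
    case (Cons x u)
    then show ?case
      by (simp add: exponent_sum_cons_red) (simp add: exponent_sum_def)
  qed (simp add: exponent_sum_def)
  then show ?thesis
    by (auto simp: abelianization_def free_group_def)
qed

lemma abelianization_gen: "i < n \<Longrightarrow> abelianization n (gen i) = unit_vec n i"
  by (auto simp: abelianization_def exponent_sum_def gen_def unit_vec_def)

lemma abelianization_carrier [simp]: "abelianization n w \<in> carrier_vec n"
  by (simp add: abelianization_def)

lemma dim_abelianization [simp]: "dim_vec (abelianization n w) = n"
  by (simp add: abelianization_def)

lemma induced_mat_carrier [simp]: "induced_mat n \<phi> \<in> carrier_mat n n"
  by (simp add: induced_mat_def mat_of_cols_carrier(1)[of n "map _ [0..<n]", simplified])

lemma dim_induced_mat [simp]: "dim_row (induced_mat n \<phi>) = n" "dim_col (induced_mat n \<phi>) = n"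
  by (simp_all add: induced_mat_def)

lemma induced_mat_col:
  "j < n \<Longrightarrow> induced_mat n \<phi> *\<^sub>v unit_vec n j = abelianization n (\<phi> (gen j))"
  by (rule eq_vecI) (auto simp: induced_mat_def mat_of_cols_index)

lemma abelianization_hom:
  assumes \<phi>: "\<phi> \<in> hom (free_group n) (free_group n)" and w: "w \<in> carrier (free_group n)"
  shows "abelianization n (\<phi> w) = induced_mat n \<phi> *\<^sub>v abelianization n w"
  using w
proof (induction w)
  let ?F = "free_group n"
  interpret \<phi>: group_hom ?F ?F \<phi>
    using \<phi> group_free_group by (auto simp: group_hom_def group_hom_axioms_def)
  let ?M = "induced_mat n \<phi>"
  have one: "abelianization n \<one>\<^bsub>?F\<^esub> = 0\<^sub>v n"
    by (auto simp: abelianization_def free_group_def exponent_sum_def)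
  have neg: "abelianization n (inv\<^bsub>?F\<^esub> u) = - abelianization n u" if "u \<in> carrier ?F" for u
  proof -
    have "abelianization n (inv\<^bsub>?F\<^esub> u) + abelianization n u = 0\<^sub>v n"
      using that one abelianization_mult[of n "inv\<^bsub>?F\<^esub> u" u] by simp
    then show ?thesis
      by (auto simp: abelianization_def vec_eq_iff)
  qed
  {
    case Nil
    have "abelianization n (\<phi> \<one>\<^bsub>?F\<^esub>) = ?M *\<^sub>v abelianization n \<one>\<^bsub>?F\<^esub>"
      by (simp only: one \<phi>.hom_one) (auto simp: mult_mat_vec_def scalar_prod_def induced_mat_def)
    then show ?case by (simp add: free_group_def)
  next
    case (Cons x w)
    then have x: "[x] \<in> carrier ?F" and w: "w \<in> carrier ?F" and i: "fst x < n"
      by (auto simp: free_group_def dest: reduced_ConsD)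
    have letter: "abelianization n (\<phi> [x]) = ?M *\<^sub>v abelianization n [x]"
    proof (cases "snd x")
      case True
      then have "[x] = gen (fst x)" by (metis gen_def prod.collapse)
      then show ?thesis using i by (simp add: abelianization_gen induced_mat_col)
    next
      case False
      then have "[x] = inv\<^bsub>?F\<^esub> gen (fst x)" by (metis inv_gen i prod.collapse)
      moreover have "?M *\<^sub>v (- unit_vec n (fst x)) = - (?M *\<^sub>v unit_vec n (fst x))"
        by (rule eq_vecI) (auto simp: induced_mat_def i)
      ultimately show ?thesis
        using i by (simp add: abelianization_gen induced_mat_col neg gen_carrier)
    qed
    have xw: "x # w = [x] \<otimes>\<^bsub>?F\<^esub> w"
      using Cons.prems by (simp add: free_group_def cons_red_reduced)
    have "abelianization n (\<phi> ([x] \<otimes>\<^bsub>?F\<^esub> w)) = ?M *\<^sub>v abelianization n ([x] \<otimes>\<^bsub>?F\<^esub> w)"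
      using x w letter Cons.IH[OF w]
      by (simp add: abelianization_mult mult_add_distrib_mat_vec[of _ n n])
    then show ?case by (simp only: xw)
  }
qed

lemma induced_mat_mult:
  assumes "\<phi> \<in> carrier (AutoGroup (free_group n))" "\<psi> \<in> carrier (AutoGroup (free_group n))"
  shows "induced_mat n (\<phi> \<otimes>\<^bsub>AutoGroup (free_group n)\<^esub> \<psi>) = induced_mat n \<phi> * induced_mat n \<psi>"
proof (rule eq_matI)
  let ?F = "free_group n"
  have \<phi>: "\<phi> \<in> hom ?F ?F" "\<phi> \<in> Bij (carrier ?F)" and \<psi>: "\<psi> \<in> hom ?F ?F" "\<psi> \<in> Bij (carrier ?F)"
    using assms by (auto simp: AutoGroup_def auto_def)
  fix i j
  assume "i < dim_row (induced_mat n \<phi> * induced_mat n \<psi>)"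
    and "j < dim_col (induced_mat n \<phi> * induced_mat n \<psi>)"
  then have ij: "i < n" "j < n"
    using induced_mat_carrier[of n \<phi>] induced_mat_carrier[of n \<psi>] by auto
  have "\<psi> (gen j) \<in> carrier ?F"
    using \<psi>(1) gen_carrier[OF ij(2)] by (auto simp: hom_def)
  then have "abelianization n ((\<phi> \<otimes>\<^bsub>AutoGroup ?F\<^esub> \<psi>) (gen j))
      = induced_mat n \<phi> *\<^sub>v abelianization n (\<psi> (gen j))"
    using \<phi> \<psi> gen_carrier[OF ij(2)]
    by (simp add: AutoGroup_def BijGroup_def compose_eq abelianization_hom)
  moreover have "abelianization n (\<psi> (gen j)) = col (induced_mat n \<psi>) j"
    using ij by (auto simp: induced_mat_def)
  ultimately show "induced_mat n (\<phi> \<otimes>\<^bsub>AutoGroup ?F\<^esub> \<psi>) $$ (i, j) =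
      (induced_mat n \<phi> * induced_mat n \<psi>) $$ (i, j)"
    using ij carrier_matD[OF induced_mat_carrier[of n \<phi>]] carrier_matD[OF induced_mat_carrier[of n \<psi>]]
    by (simp add: induced_mat_def[of n "\<phi> \<otimes>\<^bsub>AutoGroup ?F\<^esub> \<psi>"] mat_of_cols_index)
qed simp_all

lemma induced_mat_one: "induced_mat n \<one>\<^bsub>AutoGroup (free_group n)\<^esub> = 1\<^sub>m n"
  by (rule eq_matI)
     (auto simp: induced_mat_def AutoGroup_def BijGroup_def mat_of_cols_index gen_carrier
       abelianization_gen)

theorem group_SAut: "group (SAut n)"
proof -
  let ?A = "AutoGroup (free_group n)"
  let ?H = "{\<phi> \<in> carrier ?A. induced_mat n \<phi> \<in> carrier (SL n)}"
  interpret A: group ?A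
    by (rule group.AutoGroup[OF group_free_group])
  have SL_iff: "induced_mat n \<phi> \<in> carrier (SL n) \<longleftrightarrow> det (induced_mat n \<phi>) = 1" for \<phi>
    by (simp add: SL_def)
  have det_mult: "det (induced_mat n (\<phi> \<otimes>\<^bsub>?A\<^esub> \<psi>)) = det (induced_mat n \<phi>) * det (induced_mat n \<psi>)"
    if "\<phi> \<in> carrier ?A" "\<psi> \<in> carrier ?A" for \<phi> \<psi>
    using that by (simp add: induced_mat_mult det_mult[of _ n])
  have "subgroup ?H ?A"
  proof (rule A.subgroupI)
    have "\<one>\<^bsub>?A\<^esub> \<in> ?H"
      by (simp add: SL_def induced_mat_one)
    then show "?H \<noteq> {}" by blast
  next
    fix \<phi> assume \<phi>: "\<phi> \<in> ?H"
    then have "det (induced_mat n (inv\<^bsub>?A\<^esub> \<phi>)) = 1"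
      using det_mult[of "inv\<^bsub>?A\<^esub> \<phi>" \<phi>] by (simp add: SL_iff induced_mat_one)
    then show "inv\<^bsub>?A\<^esub> \<phi> \<in> ?H"
      using \<phi> by (simp add: SL_iff)
  qed (auto simp: SL_iff det_mult)
  then show ?thesis
    unfolding SAut_def by (rule A.subgroup_imp_group)
qed

section \<open>Irreducible representations and conjugacy\<close>

definition irreducible_rep ::
  "('g, 'm) monoid_scheme \<Rightarrow> nat \<Rightarrow> ('g \<Rightarrow> 'k::field mat) \<Rightarrow> bool" where
  "irreducible_rep G d \<rho> \<longleftrightarrow>
    (\<forall>W. VectorSpace.subspace class_ring W (module_vec TYPE('k) d) \<and>
         (\<forall>g\<in>carrier G. \<forall>w\<in>W. \<rho> g *\<^sub>v w \<in> W) \<longrightarrow>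
         W = {0\<^sub>v d} \<or> W = carrier_vec d)"

definition irreps :: "('g, 'm) monoid_scheme \<Rightarrow> nat \<Rightarrow> ('g \<Rightarrow> 'k::field mat) set" where
  "irreps G d = {\<rho> \<in> hom G (SL d). irreducible_rep G d \<rho>}"

text \<open>Only the values on the carrier of \<open>G\<close> are compared, because elements of \<^term>\<open>hom G H\<close>
  are arbitrary outside the carrier.\<close>

definition conjugate_reps ::
  "('g, 'm) monoid_scheme \<Rightarrow> nat \<Rightarrow> ('g \<Rightarrow> 'k::field mat) \<Rightarrow> ('g \<Rightarrow> 'k mat) \<Rightarrow> bool" where
  "conjugate_reps G d \<rho> \<sigma> \<longleftrightarrow>
    (\<exists>P\<in>carrier_mat d d. \<exists>Q\<in>carrier_mat d d. P * Q = 1\<^sub>m d \<and> Q * P = 1\<^sub>m d \<and>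
       (\<forall>g\<in>carrier G. \<sigma> g = P * \<rho> g * Q))"

definition conjugacy_rel ::
  "('g, 'm) monoid_scheme \<Rightarrow> nat \<Rightarrow> (('g \<Rightarrow> 'k::field mat) \<times> ('g \<Rightarrow> 'k mat)) set" where
  "conjugacy_rel G d = {(\<rho>, \<sigma>). \<rho> \<in> irreps G d \<and> \<sigma> \<in> irreps G d \<and> conjugate_reps G d \<rho> \<sigma>}"

lemma equiv_conjugacy_rel:
  "equiv (irreps G d) (conjugacy_rel G d :: (('g \<Rightarrow> 'k::field mat) \<times> ('g \<Rightarrow> 'k mat)) set)"
proof (rule equivI)
  have carr: "\<rho> g \<in> carrier_mat d d" if "\<rho> \<in> irreps G d" "g \<in> carrier G"
    for \<rho> :: "'g \<Rightarrow> 'k mat" and g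
    using that by (auto simp: irreps_def hom_def SL_def)
  show "(conjugacy_rel G d :: (('g \<Rightarrow> 'k mat) \<times> ('g \<Rightarrow> 'k mat)) set) \<subseteq> irreps G d \<times> irreps G d"
    by (auto simp: conjugacy_rel_def)
  show "refl_on (irreps G d) (conjugacy_rel G d :: (('g \<Rightarrow> 'k mat) \<times> ('g \<Rightarrow> 'k mat)) set)"
  proof (rule refl_onI)
    fix \<rho> :: "'g \<Rightarrow> 'k mat" assume "\<rho> \<in> irreps G d"
    then show "(\<rho>, \<rho>) \<in> conjugacy_rel G d"
      unfolding conjugacy_rel_def conjugate_reps_def
      by (auto intro!: bexI[of _ "1\<^sub>m d"]
          simp: left_mult_one_mat[OF carr] right_mult_one_mat[OF carr])
  qed
  show "sym (conjugacy_rel G d :: (('g \<Rightarrow> 'k mat) \<times> ('g \<Rightarrow> 'k mat)) set)"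
  proof (rule symI)
    fix \<rho> \<sigma> :: "'g \<Rightarrow> 'k mat" assume "(\<rho>, \<sigma>) \<in> conjugacy_rel G d"
    then obtain P Q where irr: "\<rho> \<in> irreps G d" "\<sigma> \<in> irreps G d"
      and PQ: "P \<in> carrier_mat d d" "Q \<in> carrier_mat d d" "P * Q = 1\<^sub>m d" "Q * P = 1\<^sub>m d"
      and eq: "\<And>g. g \<in> carrier G \<Longrightarrow> \<sigma> g = P * \<rho> g * Q"
      by (auto simp: conjugacy_rel_def conjugate_reps_def)
    have "\<rho> g = Q * \<sigma> g * P" if g: "g \<in> carrier G" for g
    proof -
      have "similar_mat_wit (\<sigma> g) (\<rho> g) P Q"
        using PQ eq[OF g] carr[OF irr(1) g] carr[OF irr(2) g]
        by (intro similar_mat_witI[of _ _ d]) auto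
      from similar_mat_witD2[OF carr[OF irr(1) g] similar_mat_wit_sym[OF this]]
      show ?thesis by simp
    qed
    then show "(\<sigma>, \<rho>) \<in> conjugacy_rel G d"
      using irr PQ by (auto simp: conjugacy_rel_def conjugate_reps_def)
  qed
  show "trans (conjugacy_rel G d :: (('g \<Rightarrow> 'k mat) \<times> ('g \<Rightarrow> 'k mat)) set)"
  proof (rule transI)
    fix \<rho> \<sigma> \<tau> :: "'g \<Rightarrow> 'k mat"
    assume "(\<rho>, \<sigma>) \<in> conjugacy_rel G d" "(\<sigma>, \<tau>) \<in> conjugacy_rel G d"
    then obtain P Q P' Q' where irr: "\<rho> \<in> irreps G d" "\<sigma> \<in> irreps G d" "\<tau> \<in> irreps G d"
      and PQ: "P \<in> carrier_mat d d" "Q \<in> carrier_mat d d" "P * Q = 1\<^sub>m d" "Q * P = 1\<^sub>m d"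
      and PQ': "P' \<in> carrier_mat d d" "Q' \<in> carrier_mat d d" "P' * Q' = 1\<^sub>m d" "Q' * P' = 1\<^sub>m d"
      and eq: "\<And>g. g \<in> carrier G \<Longrightarrow> \<sigma> g = P * \<rho> g * Q"
      and eq': "\<And>g. g \<in> carrier G \<Longrightarrow> \<tau> g = P' * \<sigma> g * Q'"
      by (auto simp: conjugacy_rel_def conjugate_reps_def)
    have cancel: "(A * B) * (C * D) = A * (B * C) * D"
      if "A \<in> carrier_mat d d" "B \<in> carrier_mat d d" "C \<in> carrier_mat d d" "D \<in> carrier_mat d d"
      for A B C D :: "'k mat"
      using that by (simp add: assoc_mult_mat[of _ d d _ d _ d])
    have "\<tau> g = (P' * P) * \<rho> g * (Q * Q')" if g: "g \<in> carrier G" for g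
      using PQ PQ' carr[OF irr(1) g]
      by (simp add: eq[OF g] eq'[OF g] assoc_mult_mat[of _ d d _ d _ d])
    moreover have "(P' * P) * (Q * Q') = 1\<^sub>m d" "(Q * Q') * (P' * P) = 1\<^sub>m d"
      using PQ PQ' by (simp_all add: cancel)
    ultimately have "conjugate_reps G d \<rho> \<tau>"
      unfolding conjugate_reps_def using PQ PQ'
      by (intro bexI[of _ "P' * P"] bexI[of _ "Q * Q'"]) auto
    then show "(\<rho>, \<tau>) \<in> conjugacy_rel G d"
      using irr by (simp add: conjugacy_rel_def)
  qed
qed

end

theory Submission
  imports Defs "HOL-Library.Sublist" "Jordan_Normal_Form.Char_Poly"
begin

text \<open>
  In fact every homomorphism \<open>\<rho> : SAut(F\<^sub>n) \<rightarrow> SL\<^sub>d(K)\<close> with \<open>n \<ge> 2d + 1\<close> is trivial, so there is at most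
  one conjugacy class. By Nielsen's theorem \<open>SAut(F\<^sub>n)\<close> is generated by transvections, so it suffices
  to show that the images \<open>A\<^sub>i\<^sub>j\<close> of the left (or right) transvections are trivial. Transvections with
  disjoint indices commute, and the commutator of \<open>A\<^sub>i\<^sub>j\<close> and \<open>A\<^sub>j\<^sub>k\<close> is \<open>A\<^sub>i\<^sub>k\<close>, so one trivial \<open>A\<^sub>i\<^sub>j\<close>
  forces all of them to be trivial. Induct on \<open>d\<close>: let \<open>\<mu>\<close> be an eigenvalue of \<open>A\<^sub>i\<^sub>j\<close>. If \<open>A\<^sub>i\<^sub>j = \<mu>\<close>,
  then \<open>A\<^sub>i\<^sub>j\<close> is central and \<open>A\<^sub>i\<^sub>k = 1\<close>. Otherwise the image of \<open>A\<^sub>i\<^sub>j - \<mu>\<close> is a proper nonzero subspace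
  preserved by the transvections with indices outside \<open>{i, j}\<close>. By induction they act trivially on it
  and on the quotient, so they commute with each other, and hence are trivial.

  Nielsen's theorem is proved by minimising, over a coset \<open>\<phi>H\<close>, the total length of the images of the
  generators and then the sum of the values of their initial and terminal halves.
\<close>

section \<open>Reduced words\<close>

abbreviation wmult :: "letter list \<Rightarrow> letter list \<Rightarrow> letter list" (infixr "\<odot>" 70) where
  "u \<odot> v \<equiv> foldr cons_red u v"

definition winv :: "letter list \<Rightarrow> letter list" where
  "winv w = rev (map inv_letter w)"

lemma winv_Nil [simp]: "winv [] = []"
  and winv_append [simp]: "winv (u @ v) = winv v @ winv u"
  and winv_single [simp]: "winv [x] = [inv_letter x]"
  and winv_winv [simp]: "winv (winv w) = w"
  and length_winv [simp]: "length (winv w) = length w"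
  by (auto simp: winv_def rev_map comp_def)

lemma fst_set_winv [simp]: "fst ` set (winv w) = fst ` set w"
  by (simp add: winv_def image_image)

lemma inv_letter_neq [simp]: "inv_letter x \<noteq> x" "x \<noteq> inv_letter x"
  by (auto simp: inv_letter_def prod_eq_iff)

lemma inv_letter_eq_iff: "inv_letter x = y \<longleftrightarrow> x = inv_letter y"
  by auto

lemma reduced_winv [simp]: "reduced (winv w) \<longleftrightarrow> reduced w"
proof -
  have "reduced (winv w)" if "reduced w" for w
    using that unfolding reduced_def winv_def successively_rev successively_map
    by (rule successively_mono) (auto simp: inv_letter_eq_iff)
  from this[of w] this[of "winv w"] show ?thesis by auto
qed

lemma reduced_appendD1: "reduced (u @ v) \<Longrightarrow> reduced u"
  and reduced_appendD2: "reduced (u @ v) \<Longrightarrow> reduced v"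
  by (auto simp: reduced_def successively_append_iff)

lemma reduced_append_iff:
  "reduced (u @ v) \<longleftrightarrow> reduced u \<and> reduced v \<and> (u \<noteq> [] \<and> v \<noteq> [] \<longrightarrow> hd v \<noteq> inv_letter (last u))"
  by (auto simp: reduced_def successively_append_iff)

lemma wmult_reduced: "reduced (u @ v) \<Longrightarrow> u \<odot> v = u @ v"
proof (induction u)
  case (Cons x u)
  then show ?case using reduced_ConsD[of x "u @ v"] by (simp add: cons_red_reduced)
qed simp

lemma length_wmult_le: "length (u \<odot> v) \<le> length u + length v"
proof (induction u)
  case (Cons x u)
  have "length (cons_red x w) \<le> Suc (length w)" for w by (cases w) auto
  from this[of "u \<odot> v"] Cons show ?case by simp
qed simp

text \<open>Each \<open>cons_red\<close> step adds one letter or deletes one, so a product that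
  loses no length has seen no deletion. The tie-breaking argument uses this to turn an equality of
  lengths into an actual concatenation.\<close>

lemma wmult_length_eq_imp_append:
  "reduced v \<Longrightarrow> length (u \<odot> v) \<ge> length u + length v \<Longrightarrow> u \<odot> v = u @ v"
proof (induction u)
  case (Cons x u)
  have le: "length (cons_red x w) \<le> Suc (length w)" for w by (cases w) auto
  have "length (u \<odot> v) \<ge> length u + length v" using le[of "u \<odot> v"] Cons.prems by simp
  then have "u \<odot> v = u @ v" using Cons by simp
  moreover from this have "length u + length v < length (cons_red x (u @ v))"
    using Cons.prems by simp
  ultimately show ?case using length_append[of u v] by (cases "u @ v") (auto split: if_splits)
qed simp

lemma wmult_winv_cancel: "reduced w \<Longrightarrow> winv u \<odot> (u \<odot> w) = w"
  and wmult_cancel_winv: "reduced w \<Longrightarrow> u \<odot> (winv u \<odot> w) = w"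
  using foldr_inverse[of w u] foldr_inverse[of w "winv u"]
  by (simp_all add: winv_def rev_map comp_def)

lemma wmult_cancel_prefix:
  assumes "reduced (p @ b)"
  shows "(a @ winv p) \<odot> (p @ b) = a \<odot> b"
proof -
  have "p @ b = p \<odot> b" using wmult_reduced[OF assms] by simp
  then show ?thesis using wmult_winv_cancel[of b p] reduced_appendD2[OF assms] by simp
qed

lemma winv_wmult:
  assumes "reduced u" "reduced v"
  shows "winv (u \<odot> v) = winv v \<odot> winv u"
proof -
  let ?x = "u \<odot> v"
  have x: "reduced ?x" using reduced_foldr[OF assms(2)] .
  have "?x \<odot> winv ?x = []"
    using wmult_cancel_winv[of "[]" ?x] foldr_cons_red_Nil[of "winv ?x"] x by simp
  then have "winv v \<odot> winv u = winv v \<odot> (winv u \<odot> (?x \<odot> winv ?x))"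
    using assms foldr_cons_red_Nil[of "winv u"] by simp
  also have "?x \<odot> winv ?x = u \<odot> (v \<odot> winv ?x)"
    using foldr_cons_red_assoc[of "winv ?x" u v] x by simp
  also have "winv u \<odot> (u \<odot> (v \<odot> winv ?x)) = v \<odot> winv ?x"
    using x by (intro wmult_winv_cancel reduced_foldr) simp
  also have "winv v \<odot> (v \<odot> winv ?x) = winv ?x"
    using x by (intro wmult_winv_cancel) simp
  finally show ?thesis by simp
qed

text \<open>Peel letters off the front of \<open>v\<close> while they are inverse to the last letter
  of \<open>u\<close>; \<open>p\<close> collects what cancels. Exposing \<open>p\<close> lets the
  cancellation be bounded as a common prefix of \<open>v\<close> and \<open>winv u\<close>.\<close>

lemma wmult_max_cancel:
  assumes "reduced u" "reduced v"
  obtains a p b where "u = a @ winv p" "v = p @ b" "reduced (a @ b)" "u \<odot> v = a @ b"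
proof -
  have "\<exists>a p b. u = a @ winv p \<and> v = p @ b \<and> reduced (a @ b)"
    using assms
  proof (induction v arbitrary: u)
    case Nil
    then show ?case by (intro exI[of _ u] exI[of _ "[]"]) simp
  next
    case (Cons x v)
    show ?case
    proof (cases "u \<noteq> [] \<and> last u = inv_letter x")
      case True
      then obtain u' where u: "u = u' @ [inv_letter x]" by (metis append_butlast_last_id)
      obtain a p b where "u' = a @ winv p" "v = p @ b" "reduced (a @ b)"
        using Cons.IH[of u'] Cons.prems u reduced_appendD1 reduced_ConsD by metis
      then show ?thesis
        using u winv_append[of "[x]" p] by (intro exI[of _ a] exI[of _ "x # p"] exI[of _ b]) simp
    next
      case False
      then have "reduced (u @ x # v)"
        using Cons.prems by (auto simp: reduced_append_iff inv_letter_eq_iff)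
      then show ?thesis by (intro exI[of _ u] exI[of _ "[]"] exI[of _ "x # v"]) simp
    qed
  qed
  then obtain a p b where *: "u = a @ winv p" "v = p @ b" "reduced (a @ b)" by blast
  moreover have "u \<odot> v = a @ b"
    using wmult_cancel_prefix[of p b a] wmult_reduced[OF *(3)] * assms by simp
  ultimately show thesis using that by blast
qed

text \<open>A common prefix reaching the middle would make the middle letter its own inverse (odd
  length), or the two middle letters inverse to each other (even length), against
  reducedness.\<close>

lemma prefix_winv_length:
  assumes "reduced w" "w \<noteq> []" "prefix p w" "prefix p (winv w)"
  shows "2 * length p < length w"
proof (rule ccontr)
  assume "\<not> ?thesis"
  then have le: "length w \<le> 2 * length p" by simp
  let ?L = "length w"
  have pl: "length p \<le> ?L" using assms(3) by (rule prefix_length_le)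
  have sym: "w ! (?L - Suc k) = inv_letter (w ! k)" if "k < length p" for k
  proof -
    have "winv w ! k = inv_letter (w ! (?L - Suc k))"
      using that pl by (simp add: winv_def rev_nth)
    moreover have "w ! k = p ! k" "winv w ! k = p ! k"
      using assms(3,4) that by (auto simp: prefix_def nth_append)
    ultimately show ?thesis by simp
  qed
  have L0: "?L > 0" using assms(2) by simp
  show False
  proof (cases "even ?L")
    case True
    then obtain m where m: "?L = 2 * m" by blast
    then have m0: "m > 0" using L0 by simp
    have "w ! m = inv_letter (w ! (m - 1))" using sym[of "m - 1"] m m0 le by simp
    moreover have "w ! Suc (m - 1) \<noteq> inv_letter (w ! (m - 1))"
      using assms(1) m m0 unfolding reduced_def successively_conv_nth
      by (elim allE[of _ "m - 1"]) simp
    ultimately show False using m0 by simp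
  next
    case False
    then obtain m where "?L = 2 * m + 1" using oddE by blast
    then show False using sym[of m] le by simp
  qed
qed

text \<open>This value breaks ties in the length minimisation behind Nielsen's theorem.\<close>

fun word_value :: "nat \<Rightarrow> letter list \<Rightarrow> nat" where
  "word_value n [] = 0"
| "word_value n (x # w) = (2 * fst x + of_bool (snd x)) * (2 * n) ^ length w + word_value n w"

lemma word_value_append:
  "word_value n (u @ v) = word_value n u * (2 * n) ^ length v + word_value n v"
  by (induction u) (auto simp: algebra_simps power_add)

lemma word_value_less: "fst ` set w \<subseteq> {..<n} \<Longrightarrow> word_value n w < (2 * n) ^ length w"
proof (induction w)
  case (Cons x w)
  let ?B = "(2 * n) ^ length w"
  have "2 * fst x + of_bool (snd x) + 1 \<le> 2 * n" using Cons.prems by auto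
  then have "(2 * fst x + of_bool (snd x) + 1) * ?B \<le> 2 * n * ?B" by (rule mult_le_mono1)
  moreover have "word_value n w < ?B" using Cons by simp
  ultimately show ?case by (simp add: algebra_simps)
qed simp

text \<open>Words are numerals in base \<open>2 * n\<close>, so division by the weight of the
  leading digit recovers the first letter.\<close>

lemma word_value_inject:
  assumes "length u = length v" "fst ` set u \<subseteq> {..<n}" "fst ` set v \<subseteq> {..<n}"
    and "word_value n u = word_value n v"
  shows "u = v"
  using assms
proof (induction u v rule: list_induct2)
  case (Cons x u y v)
  let ?B = "(2 * n) ^ length u"
  have u: "word_value n u < ?B" and v: "word_value n v < ?B"
    using word_value_less[of u n] word_value_less[of v n] Cons by auto
  have eq: "(2 * fst x + of_bool (snd x)) * ?B + word_value n u =
    (2 * fst y + of_bool (snd y)) * ?B + word_value n v" using Cons by simp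
  have dv: "(a * ?B + b) div ?B = a" if "b < ?B" for a b :: nat
    using that by (cases "?B = 0") (auto simp only: div_mult_self3 div_less add_0_right not_less_zero)
  have "2 * fst x + of_bool (snd x) = ((2 * fst x + of_bool (snd x)) * ?B + word_value n u) div ?B"
    using dv[OF u] by simp
  also have "\<dots> = 2 * fst y + of_bool (snd y)" unfolding eq by (rule dv[OF v])
  finally have h: "2 * fst x + of_bool (snd x) = (2 * fst y + of_bool (snd y) :: nat)" .
  then have "snd x = snd y" by (cases "snd x"; cases "snd y") (simp_all, presburger+)
  with h have "x = y" by (simp add: prod_eq_iff)
  then show ?case using Cons eq by simp
qed simp

text \<open>Adding the initial halves of \<open>w\<close> and of its inverse makes the value
  invariant under inversion, so it does not depend on the sign of the letter whose image is
  measured. For odd length, rounding down leaves out the middle letter.\<close>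

definition half_value :: "nat \<Rightarrow> letter list \<Rightarrow> nat" where
  "half_value n w = word_value n (take (length w div 2) w) + word_value n (take (length w div 2) (winv w))"

lemma half_value_winv [simp]: "half_value n (winv w) = half_value n w"
  by (simp add: half_value_def)

text \<open>Since \<open>z\<close> is at least as long as \<open>p\<close>, the replaced prefix lies
  inside the initial half, while the terminal half lies inside \<open>z\<close>. Hence only leading
  digits of the first summand change.\<close>

lemma half_value_less:
  assumes "length p = length q" "length p \<le> length z" "word_value n q < word_value n p" "n > 0"
  shows "half_value n (q @ z) < half_value n (p @ z)"
proof -
  define m where "m = (length p + length z) div 2"
  have m: "length p \<le> m" "m \<le> length z" using assms(2) by (auto simp: m_def)
  have "word_value n (take m (q @ z)) < word_value n (take m (p @ z))"
    using assms m by (simp add: word_value_append)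
  then show ?thesis using m assms(1) by (simp add: half_value_def m_def)
qed

section \<open>Transvections\<close>

lemma carrier_free_group: "carrier (free_group n) = {w. reduced w \<and> fst ` set w \<subseteq> {..<n}}"
  by (simp add: free_group_def)

lemma mult_free_group: "u \<otimes>\<^bsub>free_group n\<^esub> v = u \<odot> v"
  by (simp add: free_group_def)

lemma inv_free_group:
  assumes "u \<in> carrier (free_group n)"
  shows "inv\<^bsub>free_group n\<^esub> u = winv u"
proof (rule group.inv_equality[OF group_free_group])
  show "winv u \<otimes>\<^bsub>free_group n\<^esub> u = \<one>\<^bsub>free_group n\<^esub>"
    using assms wmult_winv_cancel[of "[]" u] foldr_cons_red_Nil[of u]
    by (simp add: free_group_def)
qed (use assms in \<open>simp_all add: carrier_free_group\<close>)

lemma letter_in_carrier [simp]: "[l] \<in> carrier (free_group n) \<longleftrightarrow> fst l < n"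
  by (simp add: carrier_free_group)

text \<open>This is the iterated product over letters to which the length estimate for Nielsen
  reduced families applies.\<close>

lemma hom_free_group_eval:
  assumes \<psi>: "\<psi> \<in> hom (free_group n) (free_group n)" and w: "w \<in> carrier (free_group n)"
  shows "\<psi> w = foldr (\<lambda>l g. \<psi> [l] \<odot> g) w []"
  using w
proof (induction w)
  interpret \<psi>: group_hom "free_group n" "free_group n" \<psi>
    using \<psi> group_free_group by (auto simp: group_hom_def group_hom_axioms_def)
  case Nil
  then show ?case using \<psi>.hom_one by (simp add: free_group_def)
next
  case (Cons x w)
  then have xw: "[x] \<in> carrier (free_group n)" "w \<in> carrier (free_group n)"
    by (auto simp: carrier_free_group dest: reduced_ConsD)
  have "\<psi> (x # w) = \<psi> ([x] \<otimes>\<^bsub>free_group n\<^esub> w)"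
    using Cons.prems by (simp add: free_group_def cons_red_reduced)
  also have "\<dots> = \<psi> [x] \<odot> \<psi> w"
    using hom_mult[OF \<psi> xw] by (simp add: mult_free_group)
  finally show ?case using Cons.IH[OF xw(2)] by simp
qed

lemma hom_free_group_reduced:
  assumes "\<psi> \<in> hom (free_group n) (free_group n)" "fst l < n"
  shows "reduced (\<psi> [l])"
  using hom_in_carrier[OF assms(1), of "[l]"] assms(2) by (simp add: carrier_free_group)

lemma hom_free_group_pair:
  assumes "\<psi> \<in> hom (free_group n) (free_group n)" "fst x < n" "fst y < n" "fst x \<noteq> fst y"
  shows "\<psi> [x, y] = \<psi> [x] \<odot> \<psi> [y]"
proof -
  have "[x, y] \<in> carrier (free_group n)" using assms by (auto simp: carrier_free_group)
  then show ?thesis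
    using hom_free_group_eval[OF assms(1)]
      foldr_cons_red_Nil[OF hom_free_group_reduced[OF assms(1,3)]] by simp
qed

lemma hom_inv_letter:
  assumes \<psi>: "\<psi> \<in> hom (free_group n) (free_group n)" and l: "fst l < n"
  shows "\<psi> [inv_letter l] = winv (\<psi> [l])"
proof -
  interpret \<psi>: group_hom "free_group n" "free_group n" \<psi>
    using \<psi> group_free_group by (auto simp: group_hom_def group_hom_axioms_def)
  have "[inv_letter l] = inv\<^bsub>free_group n\<^esub> [l]" using l inv_free_group[of "[l]" n] by simp
  then show ?thesis using l \<psi>.hom_inv[of "[l]"] inv_free_group[of "\<psi> [l]" n] by simp
qed

text \<open>One sign per generator suffices, because the value at the inverse letter follows. The
  sign is left open so that a transvection can be evaluated at the letter on which it multiplies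
  from the left.\<close>

lemma hom_free_group_ext:
  assumes \<phi>: "\<phi> \<in> hom (free_group n) (free_group n)" "\<phi> \<in> extensional (carrier (free_group n))"
    and \<psi>: "\<psi> \<in> hom (free_group n) (free_group n)" "\<psi> \<in> extensional (carrier (free_group n))"
    and eq: "\<And>i. i < n \<Longrightarrow> \<exists>b. \<phi> [(i, b)] = \<psi> [(i, b)]"
  shows "\<phi> = \<psi>"
proof (rule extensionalityI[OF \<phi>(2) \<psi>(2)])
  fix w assume w: "w \<in> carrier (free_group n)"
  have letter: "\<phi> [x] = \<psi> [x]" if x: "fst x < n" for x
  proof -
    obtain b where b: "\<phi> [(fst x, b)] = \<psi> [(fst x, b)]" using eq[OF x] by blast
    show ?thesis
    proof (cases "b = snd x")
      case False
      then have "x = inv_letter (fst x, b)" by (cases x) (auto simp: inv_letter_def)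
      then show ?thesis
        using b x hom_inv_letter[OF \<phi>(1), of "(fst x, b)"] hom_inv_letter[OF \<psi>(1), of "(fst x, b)"]
        by simp
    qed (use b in auto)
  qed
  show "\<phi> w = \<psi> w"
    unfolding hom_free_group_eval[OF \<phi>(1) w] hom_free_group_eval[OF \<psi>(1) w]
    using w by (intro foldr_cong) (auto simp: letter carrier_free_group)
qed

text \<open>Letters of both signs make this cover the left and the right Nielsen transvections and their
  inverses.\<close>

definition transvection :: "nat \<Rightarrow> letter \<Rightarrow> letter \<Rightarrow> letter list \<Rightarrow> letter list" where
  "transvection n m l =
    (THE h. h \<in> hom (free_group n) (free_group n) \<inter> extensional (carrier (free_group n)) \<and>
      (\<forall>i<n. h (gen i) = (if i \<noteq> fst m then gen i
                          else if snd m then [l, m] else [inv_letter m, inv_letter l])))"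

context
  fixes n :: nat and m l :: letter
  assumes ml: "fst m < n" "fst l < n" "fst m \<noteq> fst l"
begin

lemma transvection_spec:
  "transvection n m l \<in> hom (free_group n) (free_group n) \<inter> extensional (carrier (free_group n)) \<and>
    (\<forall>i<n. transvection n m l (gen i) = (if i \<noteq> fst m then gen i
       else if snd m then [l, m] else [inv_letter m, inv_letter l]))"
  unfolding transvection_def
  using ml by (intro theI'[OF free_group_universal[OF group_free_group]])
    (auto simp: carrier_free_group gen_def inv_letter_def prod_eq_iff)

lemma transvection_hom: "transvection n m l \<in> hom (free_group n) (free_group n)"
  and transvection_extensional: "transvection n m l \<in> extensional (carrier (free_group n))"
  using transvection_spec by auto

lemma transvection_same: "transvection n m l [m] = [l, m]"
proof (cases "snd m")
  case True
  then have "gen (fst m) = [m]" by (cases m) (auto simp: gen_def)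
  then show ?thesis using transvection_spec ml True by force
next
  case False
  then have m: "gen (fst m) = [inv_letter m]" by (cases m) (auto simp: gen_def inv_letter_def)
  then have "transvection n m l [inv_letter m] = [inv_letter m, inv_letter l]"
    using transvection_spec ml False by force
  then show ?thesis
    using hom_inv_letter[OF transvection_hom, of "inv_letter m"] ml by (simp add: winv_def)
qed

lemma transvection_other:
  assumes "fst x < n" "fst x \<noteq> fst m"
  shows "transvection n m l [x] = [x]"
proof -
  have g: "transvection n m l (gen (fst x)) = gen (fst x)" using transvection_spec assms by simp
  show ?thesis
  proof (cases "snd x")
    case True
    then have "gen (fst x) = [x]" by (cases x) (auto simp: gen_def)
    then show ?thesis using g by simp
  next
    case False
    then have "gen (fst x) = [inv_letter x]" by (cases x) (auto simp: gen_def inv_letter_def)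
    then show ?thesis
      using g hom_inv_letter[OF transvection_hom, of "inv_letter x"] assms by simp
  qed
qed

end

text \<open>On \<open>m\<close> the inner map prepends \<open>inv_letter l\<close>; the outer map
  fixes that letter and prepends \<open>l\<close> to \<open>m\<close>, so the two cancel. This
  yields bijectivity of transvections.\<close>

lemma transvection_cancel:
  assumes ml: "fst m < n" "fst l < n" "fst m \<noteq> fst l" and w: "w \<in> carrier (free_group n)"
  shows "transvection n m l (transvection n m (inv_letter l) w) = w"
proof -
  let ?F = "free_group n" and ?t = "transvection n m l" and ?s = "transvection n m (inv_letter l)"
  have ml': "fst m < n" "fst (inv_letter l) < n" "fst m \<noteq> fst (inv_letter l)" using ml by auto
  note t = transvection_hom[OF ml] and s = transvection_hom[OF ml']
  have "compose (carrier ?F) ?t ?s = (\<lambda>w\<in>carrier ?F. w)"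
  proof (rule hom_free_group_ext[of _ n])
    show "compose (carrier ?F) ?t ?s \<in> hom ?F ?F" by (rule group.hom_compose[OF group_free_group s t])
    show "(\<lambda>w\<in>carrier ?F. w) \<in> hom ?F ?F"
      using group.id_in_auto[OF group_free_group, of n] by (simp add: auto_def)
    fix i assume i: "i < n"
    show "\<exists>b. compose (carrier ?F) ?t ?s [(i, b)] = (\<lambda>w\<in>carrier ?F. w) [(i, b)]"
    proof (cases "i = fst m")
      case True
      have "?t (?s [m]) = [m]"
        using transvection_same[OF ml'] transvection_other[OF ml, of "inv_letter l"] ml
          hom_free_group_pair[OF t, of "inv_letter l" m]
        by (simp add: transvection_same[OF ml])
      then show ?thesis using True ml by (intro exI[of _ "snd m"]) (simp add: compose_def)
    next
      case False
      then show ?thesis using i ml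
        by (intro exI[of _ True])
          (simp add: compose_def transvection_other[OF ml'] transvection_other[OF ml])
    qed
  qed (auto simp: compose_def)
  then show ?thesis using w by (metis compose_eq restrict_apply')
qed

section \<open>Elements of \<open>SAut n\<close> and their products with transvections\<close>

lemma carrier_SAut:
  "carrier (SAut n) = {\<phi> \<in> hom (free_group n) (free_group n).
     \<phi> \<in> Bij (carrier (free_group n)) \<and> det (induced_mat n \<phi>) = 1}"
  by (auto simp: SAut_def AutoGroup_def auto_def SL_def)

lemma SAutD:
  assumes "\<phi> \<in> carrier (SAut n)"
  shows "\<phi> \<in> hom (free_group n) (free_group n)" "\<phi> \<in> extensional (carrier (free_group n))"
    "bij_betw \<phi> (carrier (free_group n)) (carrier (free_group n))"
  using assms by (auto simp: carrier_SAut Bij_def)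

lemma SAut_mult_apply:
  assumes "\<phi> \<in> carrier (SAut n)" "\<psi> \<in> carrier (SAut n)" "w \<in> carrier (free_group n)"
  shows "(\<phi> \<otimes>\<^bsub>SAut n\<^esub> \<psi>) w = \<phi> (\<psi> w)"
  using assms by (auto simp: SAut_def AutoGroup_def auto_def BijGroup_def compose_eq)

lemma SAut_one_apply: "w \<in> carrier (free_group n) \<Longrightarrow> \<one>\<^bsub>SAut n\<^esub> w = w"
  by (simp add: SAut_def AutoGroup_def BijGroup_def)

lemma SAut_eqI:
  assumes "\<phi> \<in> carrier (SAut n)" "\<psi> \<in> carrier (SAut n)"
    and "\<And>i. i < n \<Longrightarrow> \<exists>b. \<phi> [(i, b)] = \<psi> [(i, b)]"
  shows "\<phi> = \<psi>"
  using hom_free_group_ext[of \<phi> n \<psi>] SAutD assms by blast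

lemma transvection_in_SAut:
  assumes ml: "fst m < n" "fst l < n" "fst m \<noteq> fst l"
  shows "transvection n m l \<in> carrier (SAut n)"
proof -
  let ?F = "free_group n" and ?t = "transvection n m l" and ?s = "transvection n m (inv_letter l)"
  have ml': "fst m < n" "fst (inv_letter l) < n" "fst m \<noteq> fst (inv_letter l)" using ml by auto
  have "bij_betw ?t (carrier ?F) (carrier ?F)"
    by (rule bij_betw_byWitness[where f' = ?s])
      (use transvection_cancel[OF ml] transvection_cancel[OF ml'] hom_in_carrier[OF transvection_hom[OF ml]]
        hom_in_carrier[OF transvection_hom[OF ml']] in auto)
  moreover have "det (induced_mat n ?t) = 1"
  proof -
    \<comment> \<open>After abelianization the transvection adds \<open>s\<close> times one basis
      vector to another, where \<open>s\<close> is the product of the signs of the two letters. The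
      matrix is therefore elementary, of determinant one.\<close>
    define s :: int where "s = (if snd m = snd l then 1 else - 1)"
    have "induced_mat n ?t = addrow_mat n s (fst l) (fst m)"
    proof (rule eq_matI)
      fix i j assume "i < dim_row (addrow_mat n s (fst l) (fst m))"
        "j < dim_col (addrow_mat n s (fst l) (fst m))"
      then have ij: "i < n" "j < n" by auto
      have "?t (gen j) = (if j \<noteq> fst m then gen j
          else if snd m then [l, m] else [inv_letter m, inv_letter l])"
        using transvection_spec[OF ml] ij by simp
      then show "induced_mat n ?t $$ (i, j) = addrow_mat n s (fst l) (fst m) $$ (i, j)"
        using ij ml
        by (cases m; cases l)
          (auto simp: induced_mat_def mat_of_cols_index abelianization_def exponent_sum_def s_def
            gen_def inv_letter_def)
    qed auto
    then show ?thesis using det_addrow_mat[of "fst l" "fst m" n s] ml by simp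
  qed
  ultimately show ?thesis
    using transvection_hom[OF ml] transvection_extensional[OF ml] by (simp add: carrier_SAut Bij_def)
qed

text \<open>Right multiplication by a transvection is a Nielsen move on the tuple of images: one
  image is multiplied on the left by another, and the rest stay.\<close>

lemma SAut_mult_transvection:
  assumes \<psi>: "\<psi> \<in> carrier (SAut n)" and ml: "fst m < n" "fst l < n" "fst m \<noteq> fst l"
  shows "(\<psi> \<otimes>\<^bsub>SAut n\<^esub> transvection n m l) [m] = \<psi> [l] \<odot> \<psi> [m]"
    and "fst x < n \<Longrightarrow> fst x \<noteq> fst m \<Longrightarrow> (\<psi> \<otimes>\<^bsub>SAut n\<^esub> transvection n m l) [x] = \<psi> [x]"
proof -
  have "\<psi> [l, m] = \<psi> [l] \<odot> \<psi> [m]"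
    using hom_free_group_pair[OF SAutD(1)[OF \<psi>] ml(2,1)] ml(3) by simp
  then show "(\<psi> \<otimes>\<^bsub>SAut n\<^esub> transvection n m l) [m] = \<psi> [l] \<odot> \<psi> [m]"
    using SAut_mult_apply[OF \<psi> transvection_in_SAut[OF ml], of "[m]"] ml
    by (simp add: transvection_same)
  show "fst x < n \<Longrightarrow> fst x \<noteq> fst m \<Longrightarrow> (\<psi> \<otimes>\<^bsub>SAut n\<^esub> transvection n m l) [x] = \<psi> [x]"
    using SAut_mult_apply[OF \<psi> transvection_in_SAut[OF ml], of "[x]"] ml
    by (simp add: transvection_other)
qed

section \<open>Nielsen's theorem\<close>

text \<open>\<open>half\<close> and \<open>halves\<close> bound the cancellation on the left of each \<open>y l\<close> by half its length, and
  forbid half of \<open>y l\<close> being cancelled from both sides; so a letter of every factor survives.\<close>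

lemma nielsen_reduced_length_le:
  fixes y :: "letter \<Rightarrow> letter list"
  assumes red: "\<And>l. fst l < n \<Longrightarrow> reduced (y l)"
    and ne: "\<And>l. fst l < n \<Longrightarrow> y l \<noteq> []"
    and inv: "\<And>l. fst l < n \<Longrightarrow> y (inv_letter l) = winv (y l)"
    and half: "\<And>l m p. \<lbrakk>fst l < n; fst m < n; l \<noteq> m; prefix p (y l); prefix p (y m)\<rbrakk> \<Longrightarrow>
      2 * length p \<le> length (y l)"
    and halves: "\<And>l l1 l2 p q. \<lbrakk>fst l < n; fst l1 < n; fst l2 < n; l1 \<noteq> l; l2 \<noteq> inv_letter l;
      y l = p @ winv q; length p = length q; prefix p (y l1); prefix q (y l2)\<rbrakk> \<Longrightarrow> False"
    and w: "reduced w" "fst ` set w \<subseteq> {..<n}"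
  shows "length w \<le> length (foldr (\<lambda>l g. y l \<odot> g) w [])"
proof -
  \<comment> \<open>Placed before \<open>y l\<close>, the word \<open>y (inv_letter m)\<close>
    cancels exactly the common prefix of \<open>y m\<close> and \<open>y l\<close>. So
    \<open>c l\<close> is the largest possible cancellation at the left end of \<open>y l\<close>,
    and \<open>c (inv_letter l)\<close> the largest at its right end.\<close>
  define K where "K l = {length p | p m. fst m < n \<and> m \<noteq> l \<and> prefix p (y l) \<and> prefix p (y m)}" for l
  define c where "c l = Max (K l)" for l
  have K_fin: "finite (K l)" for l
    by (rule finite_subset[of _ "{..length (y l)}"]) (auto simp: K_def dest: prefix_length_le)
  have c_ge: "length p \<le> c l" if "fst m < n" "m \<noteq> l" "prefix p (y l)" "prefix p (y m)" for l m p
    unfolding c_def using that by (intro Max_ge K_fin) (unfold K_def, blast)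
  have c_in: "\<exists>p m. c l = length p \<and> fst m < n \<and> m \<noteq> l \<and> prefix p (y l) \<and> prefix p (y m)"
    if "fst l < n" for l
  proof -
    have "length [] \<in> K l"
      unfolding K_def mem_Collect_eq using that
      by (intro exI[of _ "[]"] exI[of _ "inv_letter l"]) simp
    then have "c l \<in> K l" unfolding c_def by (intro Max_in K_fin) auto
    then show ?thesis by (auto simp: K_def)
  qed
  \<comment> \<open>Each of the two cancellations takes at most half of \<open>y l\<close>. Together
    they could exhaust it only if both were exactly half, which is the case excluded by
    \<open>halves\<close>.\<close>
  have c_sum: "c l + c (inv_letter l) < length (y l)" if l: "fst l < n" for l
  proof -
    obtain p m where p: "c l = length p" "fst m < n" "m \<noteq> l" "prefix p (y l)" "prefix p (y m)"
      using c_in[OF l] by blast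
    obtain q m' where q: "c (inv_letter l) = length q" "fst m' < n" "m' \<noteq> inv_letter l"
        "prefix q (y (inv_letter l))" "prefix q (y m')"
      using c_in[of "inv_letter l"] l by auto
    have p2: "2 * length p \<le> length (y l)" using half[OF l p(2) _ p(4,5)] p(3) by auto
    have q2: "2 * length q \<le> length (y l)"
      using half[OF _ q(2) _ q(4,5)] q(3) l inv[OF l] by auto
    have "length p + length q \<noteq> length (y l)"
    proof
      assume eq: "length p + length q = length (y l)"
      then have pq: "length p = length q" using p2 q2 by simp
      obtain a where a: "y l = p @ a" using p(4) by (auto simp: prefix_def)
      obtain b where "winv (y l) = q @ b" using q(4) inv[OF l] by (auto simp: prefix_def)
      then have "winv (winv (y l)) = winv (q @ b)" by (simp only:)
      then have b: "y l = winv b @ winv q" by simp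
      have "length (winv b) = length p" using b eq by simp
      then have "y l = p @ winv q" using a b by (metis append_eq_append_conv)
      then show False using halves[OF l p(2) q(2) p(3) q(3) _ pq p(5) q(5)] by blast
    qed
    then show ?thesis using p(1) q(1) p2 q2 by linarith
  qed
  define Y where "Y w = foldr (\<lambda>l g. y l \<odot> g) w []" for w
  have Y_red: "reduced (Y w)" for w
    by (induction w) (auto simp: Y_def intro: reduced_foldr)
  \<comment> \<open>Inductive invariant: the product begins with the part of \<open>y l\<close> that
    is safe from cancellation on its right, and what follows has at least one letter for each
    further factor.\<close>
  have main: "\<exists>r. Y (l # w) = take (length (y l) - c (inv_letter l)) (y l) @ r \<and> length w \<le> length r"
    if "reduced (l # w)" "fst ` set (l # w) \<subseteq> {..<n}" for l w
    using that
  proof (induction w arbitrary: l)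
    case Nil
    have "Y [l] = y l" using foldr_cons_red_Nil[OF red[of l]] Nil by (simp add: Y_def)
    then show ?case by (metis append_take_drop_id le0 list.size(3))
  next
    case (Cons m w)
    have lm: "fst l < n" "fst m < n" "m \<noteq> inv_letter l" using Cons.prems by auto
    define t where "t = take (length (y m) - c (inv_letter m)) (y m)"
    obtain r where r: "Y (m # w) = t @ r" "length w \<le> length r"
      using Cons.IH[of m] Cons.prems by (auto simp: t_def dest: reduced_ConsD)
    have t_len: "c m < length t" using c_sum[OF lm(2)] by (simp add: t_def)
    obtain a p b where d: "y l = a @ winv p" "t @ r = p @ b" "y l \<odot> (t @ r) = a @ b"
      using wmult_max_cancel[OF red[OF lm(1)] Y_red[of "m # w"]] unfolding r(1) by metis
    have il: "y (inv_letter l) = p @ winv a" using inv[OF lm(1)] d(1) by simp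
    \<comment> \<open>A priori the cancelled word \<open>p\<close> could run past \<open>t\<close>.
      Its truncation is a common prefix of \<open>y m\<close> and \<open>y (inv_letter l)\<close>,
      hence of length at most \<open>c m < length t\<close>, so nothing was truncated.\<close>
    define p' where "p' = take (length t) p"
    have "prefix p' t" using d(2) unfolding p'_def
      by (metis append_eq_conv_conj prefix_def take_append take_is_prefix take_take min.commute)
    then have pm: "prefix p' (y m)" unfolding t_def using prefix_order.trans take_is_prefix by blast
    have pl: "prefix p' (y (inv_letter l))"
      unfolding il p'_def using take_is_prefix[of "length t" p] by auto
    have "length p' \<le> c m" using c_ge[of "inv_letter l" m p'] lm pm pl by auto
    then have "length p < length t" using t_len by (auto simp: p'_def)
    then have "p' = p" by (simp add: p'_def)
    then have "length p \<le> c (inv_letter l)" using c_ge[of m "inv_letter l" p] lm pm pl by auto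
    then have "length (y l) - c (inv_letter l) \<le> length a" using d(1) by simp
    then have a: "take (length (y l) - c (inv_letter l)) (y l) @
        drop (length (y l) - c (inv_letter l)) a = a" using d(1) by simp
    have "length p + length b = length t + length r" using arg_cong[OF d(2), of length] by simp
    then have "Suc (length w) \<le> length b" using \<open>length p < length t\<close> r(2) by simp
    moreover have "Y (l # m # w) = a @ b" using d(3) r(1) by (simp add: Y_def)
    ultimately show ?case
      using a by (intro exI[of _ "drop (length (y l) - c (inv_letter l)) a @ b"])
        (simp flip: append_assoc)
  qed
  show ?thesis
  proof (cases w)
    case (Cons l w')
    obtain r where r: "Y w = take (length (y l) - c (inv_letter l)) (y l) @ r" "length w' \<le> length r"
      using main[of l w'] w Cons by auto
    have "0 < length (y l) - c (inv_letter l)" "0 < length (y l)"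
      using c_sum[of l] w Cons by auto
    then show ?thesis using r Cons by (simp add: Y_def)
  qed simp
qed

section \<open>Automorphisms that are minimal under Nielsen moves\<close>

lemma sum_change_one:
  fixes f g :: "nat \<Rightarrow> nat"
  assumes "k < n" "\<And>i. i < n \<Longrightarrow> i \<noteq> k \<Longrightarrow> f i = g i"
  shows "(\<Sum>i<n. f i) < (\<Sum>i<n. g i) \<longleftrightarrow> f k < g k"
    and "(\<Sum>i<n. f i) = (\<Sum>i<n. g i) \<longleftrightarrow> f k = g k"
proof -
  have "(\<Sum>i<n. f i) = f k + (\<Sum>i\<in>{..<n} - {k}. f i)"
    using assms(1) by (intro sum.remove) auto
  moreover have "(\<Sum>i<n. g i) = g k + (\<Sum>i\<in>{..<n} - {k}. g i)"
    using assms(1) by (intro sum.remove) auto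
  moreover have "(\<Sum>i\<in>{..<n} - {k}. f i) = (\<Sum>i\<in>{..<n} - {k}. g i)"
    using assms(2) by (intro sum.cong) auto
  ultimately show "(\<Sum>i<n. f i) < (\<Sum>i<n. g i) \<longleftrightarrow> f k < g k"
    "(\<Sum>i<n. f i) = (\<Sum>i<n. g i) \<longleftrightarrow> f k = g k" by simp_all
qed

lemma letter_cases_gen: "[l] = gen (fst l) \<or> [l] = [inv_letter (fst l, True)]"
  by (cases l) (auto simp: gen_def inv_letter_def)

lemma hom_letter_gen:
  assumes "\<psi> \<in> hom (free_group n) (free_group n)" "fst l < n"
  shows "\<psi> [l] = \<psi> (gen (fst l)) \<or> \<psi> [l] = winv (\<psi> (gen (fst l)))"
  using letter_cases_gen[of l] hom_inv_letter[OF assms(1), of "(fst l, True)"] assms(2)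
  by (auto simp: gen_def)

text \<open>Minimality makes the images of the letters Nielsen reduced, so the preimage of a
  generator has length one. Thus every generator is the image of a letter, and counting indices
  shows that all images of generators are letters.\<close>

lemma nielsen_minimal_letters:
  assumes \<psi>: "\<psi> \<in> hom (free_group n) (free_group n)"
    and bij: "bij_betw \<psi> (carrier (free_group n)) (carrier (free_group n))"
    and len: "\<And>m l. \<lbrakk>fst m < n; fst l < n; fst m \<noteq> fst l\<rbrakk> \<Longrightarrow>
      length (\<psi> [m]) \<le> length (\<psi> [l] \<odot> \<psi> [m])"
    and val: "\<And>m l. \<lbrakk>fst m < n; fst l < n; fst m \<noteq> fst l;
      length (\<psi> [l] \<odot> \<psi> [m]) = length (\<psi> [m])\<rbrakk> \<Longrightarrow>
      half_value n (\<psi> [m]) \<le> half_value n (\<psi> [l] \<odot> \<psi> [m])"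
    and i: "i < n"
  shows "length (\<psi> (gen i)) = 1"
proof -
  define y where "y l = \<psi> [l]" for l
  have n0: "n > 0" using i by simp
  have cl: "y l \<in> carrier (free_group n)" if "fst l < n" for l
    using hom_in_carrier[OF \<psi>, of "[l]"] that by (simp add: y_def)
  have red: "reduced (y l)" and lets: "fst ` set (y l) \<subseteq> {..<n}" if "fst l < n" for l
    using cl[OF that] by (auto simp: carrier_free_group)
  have inv: "y (inv_letter l) = winv (y l)" if "fst l < n" for l
    using hom_inv_letter[OF \<psi> that] by (simp add: y_def)
  have nil: "[] \<in> carrier (free_group n)" "\<psi> [] = []"
    using hom_free_group_eval[OF \<psi>, of "[]"] by (auto simp: carrier_free_group)
  have ne: "y l \<noteq> []" if "fst l < n" for l
  proof
    assume "y l = []"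
    then have "\<psi> [l] = \<psi> []" using nil by (simp add: y_def)
    then have "[l] = []"
      using that nil(1) by (intro inj_onD[OF bij_betw_imp_inj_on[OF bij], of "[l]" "[]"]) simp_all
    then show False by simp
  qed
  have fst_eq: "m = l \<or> m = inv_letter l" if "fst m = fst l" for m l :: letter
    using that by (cases m; cases l) (auto simp: inv_letter_def)
  \<comment> \<open>With \<open>y l = p @ a\<close> and \<open>y m = p @ b\<close>, multiplying
    \<open>y m\<close> by the inverse of \<open>y l\<close> leaves at most
    \<open>length a + length b\<close> letters; minimality then gives
    \<open>length p \<le> length a\<close>. Letters over the same generator are covered by
    \<open>prefix_winv_length\<close>.\<close>
  have half: "2 * length p \<le> length (y l)"
    if lm: "fst l < n" "fst m < n" "l \<noteq> m" and p: "prefix p (y l)" "prefix p (y m)" for l m p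
  proof (cases "fst l = fst m")
    case True
    then have "m = inv_letter l" using fst_eq[of m l] lm(3) by auto
    then show ?thesis using prefix_winv_length[OF red ne p(1)] p(2) inv lm by fastforce
  next
    case False
    obtain a b where a: "y l = p @ a" and b: "y m = p @ b" using p by (auto simp: prefix_def)
    have "length (p @ b) \<le> length (winv (p @ a) \<odot> (p @ b))"
      using len[of m "inv_letter l"] lm False inv[of l] a b by (simp add: y_def)
    also have "winv (p @ a) \<odot> (p @ b) = winv a \<odot> b"
      using wmult_cancel_prefix[of p b "winv a"] red[OF lm(2)] b by simp
    also have "length \<dots> \<le> length a + length b" using length_wmult_le[of "winv a" b] by simp
    finally show ?thesis using a by simp
  qed
  \<comment> \<open>Multiplying \<open>y l1\<close> by the inverse of \<open>y l\<close> trades the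
    prefix \<open>p\<close> for \<open>q\<close>. Minimal length rules out further cancellation, so
    the move keeps the length and lowers \<open>half_value\<close>.\<close>
  have tie: False
    if l: "fst l < n" "fst l1 < n" "fst l1 \<noteq> fst l" and d: "y l = p @ winv q" "length p = length q"
      and p: "prefix p (y l1)" and less: "word_value n q < word_value n p" for l l1 p q
  proof -
    obtain z where z: "y l1 = p @ z" using p by (auto simp: prefix_def)
    have "2 * length p \<le> length (y l1)"
      using half[of l1 l p] l p d by auto
    then have pz: "length p \<le> length z" using z by simp
    have eq: "y (inv_letter l) \<odot> y l1 = q \<odot> z"
      using wmult_cancel_prefix[of p z q] red[OF l(2)] z inv[OF l(1)] d by simp
    have "length (y l1) \<le> length (q \<odot> z)"
      using len[of l1 "inv_letter l"] l eq by (simp add: y_def)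
    then have qz: "q \<odot> z = q @ z"
      using red[OF l(2)] z d(2) reduced_appendD2 by (intro wmult_length_eq_imp_append) auto
    then have "half_value n (p @ z) \<le> half_value n (q @ z)"
      using val[of l1 "inv_letter l"] l eq z d(2) by (simp add: y_def)
    then show False using half_value_less[OF d(2) pz less n0] by simp
  qed
  \<comment> \<open>The halves differ, as a nonempty reduced word is never its own inverse.
    Whichever has the larger value can be traded for the other, using \<open>tie\<close> for
    \<open>l\<close> or for \<open>inv_letter l\<close>.\<close>
  have halves: False
    if l: "fst l < n" "fst l1 < n" "fst l2 < n" "l1 \<noteq> l" "l2 \<noteq> inv_letter l"
      and d: "y l = p @ winv q" "length p = length q" and p: "prefix p (y l1)" and q: "prefix q (y l2)"
    for l l1 l2 p q
  proof -
    have iv: "y (inv_letter l) = q @ winv p" using inv[OF l(1)] d(1) by simp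
    have pq: "p \<noteq> q"
    proof
      assume "p = q"
      then have "2 * length p < length (y l)"
        using iv d inv[OF l(1)] by (intro prefix_winv_length red ne l) auto
      then show False using d by simp
    qed
    have same: "u = v" if "prefix u (v @ x)" "length u = length v" for u v x :: "letter list"
      using that by (metis append_eq_append_conv prefix_def)
    have l1: "fst l1 \<noteq> fst l"
      using fst_eq[of l1 l] l(4) same[of p q "winv p"] p iv d(2) pq by auto
    have l2: "fst l2 \<noteq> fst l"
      using fst_eq[of l2 l] l(5) same[of q p "winv q"] q d pq by auto
    have "fst ` set p \<subseteq> {..<n}" "fst ` set q \<subseteq> {..<n}"
      using lets[OF l(1)] lets[of "inv_letter l"] l(1) d(1) iv by auto
    then have "word_value n p \<noteq> word_value n q"
      using word_value_inject[OF d(2)] pq by blast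
    then consider "word_value n q < word_value n p" | "word_value n p < word_value n q" by linarith
    then show False
    proof cases
      case 1
      show False using tie[OF l(1,2) l1 d p 1] .
    next
      case 2
      show False using tie[of "inv_letter l" l2 q p] iv d(2) l l2 q 2 by simp
    qed
  qed
  have ex: "\<exists>l. fst l < n \<and> y l = [(j, True)]" if j: "j < n" for j
  proof -
    have "[(j, True)] \<in> \<psi> ` carrier (free_group n)"
      using bij_betw_imp_surj_on[OF bij] j by simp
    then obtain w where w: "w \<in> carrier (free_group n)" "\<psi> w = [(j, True)]" by (metis imageE)
    have wc: "reduced w" "fst ` set w \<subseteq> {..<n}" using w(1) by (auto simp: carrier_free_group)
    have "length w \<le> length (foldr (\<lambda>l g. y l \<odot> g) w [])"
      by (rule nielsen_reduced_length_le[of n y w]; fact)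
    then have "length w \<le> 1"
      unfolding y_def hom_free_group_eval[OF \<psi> w(1), symmetric] w(2) by simp
    moreover have "w \<noteq> []" using w(2) nil by auto
    ultimately obtain l where "w = [l]" by (cases w) auto
    then show ?thesis using w by (intro exI[of _ l]) (simp add: y_def)
  qed
  then obtain e where e: "\<And>j. j < n \<Longrightarrow> fst (e j) < n \<and> y (e j) = [(j, True)]" by metis
  \<comment> \<open>Letters over one generator have equal or inverse images, whereas distinct
    positive letters are neither. By finiteness every index, in particular \<open>i\<close>, then
    occurs as some \<open>fst (e j)\<close>.\<close>
  have "inj_on (\<lambda>j. fst (e j)) {..<n}"
  proof (rule inj_onI)
    fix j k assume jk: "j \<in> {..<n}" "k \<in> {..<n}" "fst (e j) = fst (e k)"
    then have "e j = e k \<or> e j = inv_letter (e k)" by (intro fst_eq)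
    moreover have "winv (y (e k)) = y (inv_letter (e k))" using inv[of "e k"] e[of k] jk by simp
    ultimately have "y (e j) = y (e k) \<or> y (e j) = winv (y (e k))" by auto
    then show "j = k" using e[of j] e[of k] jk by (auto simp: inv_letter_def)
  qed
  then have "(\<lambda>j. fst (e j)) ` {..<n} = {..<n}" using e by (intro endo_inj_surj) auto
  then obtain j where j: "j < n" "fst (e j) = i" using i by (metis imageE lessThan_iff)
  have "length (\<psi> [e j]) = 1" using e[OF j(1)] by (simp add: y_def)
  then show ?thesis
    using hom_letter_gen[OF \<psi>, of "e j"] e[OF j(1)] j(2) length_winv by metis
qed

section \<open>Sets closed under right multiplication by transvections\<close>

context
  fixes n :: nat and C :: "(letter list \<Rightarrow> letter list) set"
  assumes C: "C \<subseteq> carrier (SAut n)"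
    and closed: "\<And>\<psi> m l. \<lbrakk>\<psi> \<in> C; fst m < n; fst l < n; fst m \<noteq> fst l\<rbrakk> \<Longrightarrow>
      \<psi> \<otimes>\<^bsub>SAut n\<^esub> transvection n m l \<in> C"
begin

text \<open>Choose \<open>\<psi>\<close> lexicographically minimal for total length, then total
  \<open>half_value\<close>. A Nielsen move changes one summand only, and both measures ignore
  inversion, so minimality can be read off at letters of either sign.\<close>

lemma ex_signed_permutation:
  assumes "C \<noteq> {}"
  shows "\<exists>\<psi>\<in>C. \<forall>i<n. length (\<psi> (gen i)) = 1"
proof -
  define L where "L \<psi> = (\<Sum>i<n. length (\<psi> (gen i)))" for \<psi> :: "letter list \<Rightarrow> letter list"
  define V where "V \<psi> = (\<Sum>i<n. half_value n (\<psi> (gen i)))" for \<psi> :: "letter list \<Rightarrow> letter list"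
  obtain \<psi> where \<psi>: "\<psi> \<in> C" and "\<And>\<chi>. (\<chi>, \<psi>) \<in> measures [L, V] \<Longrightarrow> \<chi> \<notin> C"
    using wfE_min[OF wf_measures[of "[L, V]"], of _ C] assms by blast
  then have min: "\<not> (L \<chi> < L \<psi> \<or> (L \<chi> = L \<psi> \<and> V \<chi> < V \<psi>))" if "\<chi> \<in> C" for \<chi>
    using that by auto
  have S: "\<psi> \<in> carrier (SAut n)" using \<psi> C by blast
  note h = SAutD[OF S]
  have cmp: "(length (\<psi> [m]) \<le> length (\<psi> [l] \<odot> \<psi> [m])) \<and>
    (length (\<psi> [l] \<odot> \<psi> [m]) = length (\<psi> [m]) \<longrightarrow>
     half_value n (\<psi> [m]) \<le> half_value n (\<psi> [l] \<odot> \<psi> [m]))"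
    if ml: "fst m < n" "fst l < n" "fst m \<noteq> fst l" for m l
  proof -
    define \<chi> where "\<chi> = \<psi> \<otimes>\<^bsub>SAut n\<^esub> transvection n m l"
    have \<chi>: "\<chi> \<in> C" "\<chi> \<in> carrier (SAut n)" using closed[OF \<psi> ml] C by (auto simp: \<chi>_def)
    have other: "\<chi> (gen i) = \<psi> (gen i)" if "i < n" "i \<noteq> fst m" for i
      using SAut_mult_transvection(2)[OF S ml, of "(i, True)"] that by (simp add: \<chi>_def gen_def)
    have same: "length (\<chi> (gen (fst m))) = length (\<psi> [l] \<odot> \<psi> [m])"
        "half_value n (\<chi> (gen (fst m))) = half_value n (\<psi> [l] \<odot> \<psi> [m])"
      using hom_letter_gen[OF SAutD(1)[OF \<chi>(2)] ml(1)] SAut_mult_transvection(1)[OF S ml]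
      by (auto simp: \<chi>_def)
    have same': "length (\<psi> (gen (fst m))) = length (\<psi> [m])"
        "half_value n (\<psi> (gen (fst m))) = half_value n (\<psi> [m])"
      using hom_letter_gen[OF h(1) ml(1)] by auto
    have "L \<chi> < L \<psi> \<longleftrightarrow> length (\<psi> [l] \<odot> \<psi> [m]) < length (\<psi> [m])"
      "L \<chi> = L \<psi> \<longleftrightarrow> length (\<psi> [l] \<odot> \<psi> [m]) = length (\<psi> [m])"
      "V \<chi> < V \<psi> \<longleftrightarrow> half_value n (\<psi> [l] \<odot> \<psi> [m]) < half_value n (\<psi> [m])"
      unfolding L_def V_def same[symmetric] same'[symmetric]
      using other ml(1) by (intro sum_change_one; simp)+
    then show ?thesis using min[OF \<chi>(1)] by auto
  qed
  have "length (\<psi> (gen i)) = 1" if "i < n" for i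
    using cmp by (intro nielsen_minimal_letters[OF h(1,3) _ _ that]) auto
  then show ?thesis using \<psi> by blast
qed

text \<open>With images a, b of the two generators, three moves give (a, b), (ba, b), (ba, a^-1),
  (b, a^-1). A plain swap has determinant -1, hence the inverse.\<close>

lemma ex_swap:
  assumes \<psi>: "\<psi> \<in> C" and ij: "i < n" "j < n" "i \<noteq> j"
  shows "\<exists>\<chi>\<in>C. \<chi> (gen i) = \<psi> (gen j) \<and> \<chi> (gen j) = winv (\<psi> (gen i)) \<and>
    (\<forall>k<n. k \<noteq> i \<longrightarrow> k \<noteq> j \<longrightarrow> \<chi> (gen k) = \<psi> (gen k))"
proof -
  let ?m = "(i, True)" and ?l = "(j, True)" and ?m' = "(i, False)" and ?l' = "(j, False)"
  define \<psi>1 where "\<psi>1 = \<psi> \<otimes>\<^bsub>SAut n\<^esub> transvection n ?m ?l"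
  define \<psi>2 where "\<psi>2 = \<psi>1 \<otimes>\<^bsub>SAut n\<^esub> transvection n ?l ?m'"
  define \<psi>3 where "\<psi>3 = \<psi>2 \<otimes>\<^bsub>SAut n\<^esub> transvection n ?m' ?l'"
  have c1: "\<psi>1 \<in> C" unfolding \<psi>1_def using \<psi> ij by (intro closed) auto
  have c2: "\<psi>2 \<in> C" unfolding \<psi>2_def using c1 ij by (intro closed) auto
  have c3: "\<psi>3 \<in> C" unfolding \<psi>3_def using c2 ij by (intro closed) auto
  have S: "\<psi> \<in> carrier (SAut n)" "\<psi>1 \<in> carrier (SAut n)" "\<psi>2 \<in> carrier (SAut n)"
    "\<psi>3 \<in> carrier (SAut n)" using \<psi> c1 c2 c3 C by auto
  have neg: "\<phi> [(k, False)] = winv (\<phi> [(k, True)])" if "\<phi> \<in> carrier (SAut n)" "k < n" for \<phi> k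
    using hom_inv_letter[OF SAutD(1)[OF that(1)], of "(k, True)"] that(2)
    by (simp add: inv_letter_def)
  define a b where "a = \<psi> [?m]" and "b = \<psi> [?l]"
  have r: "reduced a" "reduced b"
    using hom_free_group_reduced[OF SAutD(1)[OF S(1)]] ij by (auto simp: a_def b_def)
  have 1: "\<psi>1 [?m] = b \<odot> a" "\<psi>1 [?l] = b"
    using SAut_mult_transvection[OF S(1), of ?m ?l] ij by (auto simp: \<psi>1_def a_def b_def)
  have w: "winv (b \<odot> a) = winv a \<odot> winv b" by (rule winv_wmult[OF r(2,1)])
  have "\<psi>2 [?l] = (winv a \<odot> winv b) \<odot> b"
    using SAut_mult_transvection(1)[OF S(2), of ?l ?m'] ij 1 neg[OF S(2), of i] w
    by (simp add: \<psi>2_def)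
  also have "\<dots> = winv a \<odot> (winv b \<odot> b)" by (rule foldr_cons_red_assoc[OF r(2)])
  also have "winv b \<odot> b = []"
    using wmult_winv_cancel[of "[]" b] foldr_cons_red_Nil[OF r(2)] by simp
  also have "winv a \<odot> [] = winv a" using r by (intro foldr_cons_red_Nil) simp
  finally have 2: "\<psi>2 [?l] = winv a" .
  have m2: "\<psi>2 [?m] = b \<odot> a"
    using SAut_mult_transvection(2)[OF S(2), of ?l ?m' ?m] ij 1 by (simp add: \<psi>2_def)
  have "\<psi>3 [?m'] = a \<odot> (winv a \<odot> winv b)"
    using SAut_mult_transvection(1)[OF S(3), of ?m' ?l'] ij 2 m2 neg[OF S(3)] w
    by (simp add: \<psi>3_def)
  also have "\<dots> = winv b" using r by (intro wmult_cancel_winv) simp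
  finally have "winv (\<psi>3 [?m]) = winv b" using neg[OF S(4) ij(1)] by simp
  then have "winv (winv (\<psi>3 [?m])) = winv (winv b)" by (simp only:)
  then have "\<psi>3 [?m] = b" by simp
  moreover have "\<psi>3 [?l] = winv a"
    using SAut_mult_transvection(2)[OF S(3), of ?m' ?l' ?l] ij 2 by (simp add: \<psi>3_def)
  moreover have "\<psi>3 [(k, True)] = \<psi> [(k, True)]" if "k < n" "k \<noteq> i" "k \<noteq> j" for k
    using SAut_mult_transvection(2)[OF S(1), of ?m ?l "(k, True)"]
      SAut_mult_transvection(2)[OF S(2), of ?l ?m' "(k, True)"]
      SAut_mult_transvection(2)[OF S(3), of ?m' ?l' "(k, True)"] ij that
    by (simp add: \<psi>1_def \<psi>2_def \<psi>3_def)
  ultimately show ?thesis using c3 by (intro bexI[of _ \<psi>3]) (auto simp: a_def b_def gen_def)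
qed

text \<open>Among the signed permutations in \<open>C\<close>, minimise the number of displaced
  generators, then the number of inverted ones. Swaps show that none is displaced and at most one
  inverted; determinant one excludes that last inversion.\<close>

lemma one_in_closed_set:
  assumes "C \<noteq> {}"
  shows "\<one>\<^bsub>SAut n\<^esub> \<in> C"
proof -
  define D where "D = {\<psi> \<in> C. \<forall>i<n. length (\<psi> (gen i)) = 1}"
  define bad where "bad \<psi> = {i. i < n \<and> fst (hd (\<psi> (gen i))) \<noteq> i}"
    for \<psi> :: "letter list \<Rightarrow> letter list"
  define neg where "neg \<psi> = {i. i < n \<and> \<not> snd (hd (\<psi> (gen i)))}"
    for \<psi> :: "letter list \<Rightarrow> letter list"
  have fin: "finite (bad \<psi>)" "finite (neg \<psi>)" for \<psi> by (auto simp: bad_def neg_def)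
  have "D \<noteq> {}" using ex_signed_permutation[OF assms] by (auto simp: D_def)
  then obtain \<psi> where \<psi>: "\<psi> \<in> D"
    and "\<And>\<chi>. (\<chi>, \<psi>) \<in> measures [\<lambda>\<psi>. card (bad \<psi>), \<lambda>\<psi>. card (neg \<psi>)] \<Longrightarrow> \<chi> \<notin> D"
    using wfE_min[OF wf_measures[of "[\<lambda>\<psi>. card (bad \<psi>), \<lambda>\<psi>. card (neg \<psi>)]"], of _ D] by blast
  then have min: "\<not> card (bad \<chi>) < card (bad \<psi>)"
    "\<not> (card (bad \<chi>) = card (bad \<psi>) \<and> card (neg \<chi>) < card (neg \<psi>))" if "\<chi> \<in> D" for \<chi>
    using that by auto
  have \<psi>C: "\<psi> \<in> C" and S: "\<psi> \<in> carrier (SAut n)" using \<psi> C by (auto simp: D_def)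
  note h = SAutD[OF S]
  define f where "f i = hd (\<psi> (gen i))" for i
  have f: "\<psi> (gen i) = [f i]" if "i < n" for i
    using \<psi> that by (auto simp: D_def f_def length_Suc_conv)
  have fn: "fst (f i) < n" if "i < n" for i
    using hom_in_carrier[OF h(1) gen_carrier[OF that]] f[OF that] by simp
  have inj: "inj_on (\<lambda>i. fst (f i)) {..<n}"
  proof (rule inj_onI)
    fix i j assume ij: "i \<in> {..<n}" "j \<in> {..<n}" "fst (f i) = fst (f j)"
    have "f i = f j \<or> f i = inv_letter (f j)"
      using ij(3) by (cases "f i"; cases "f j") (auto simp: inv_letter_def)
    then have "\<psi> [(i, True)] = \<psi> [(j, True)] \<or> \<psi> [(i, True)] = \<psi> [inv_letter (j, True)]"
      using f[of i] f[of j] ij hom_inv_letter[OF h(1), of "(j, True)"] by (auto simp: gen_def)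
    then have "[(i, True)] = [(j, True)] \<or> [(i, True)] = [inv_letter (j, True)]"
      using inj_onD[OF bij_betw_imp_inj_on[OF h(3)], of "[(i, True)]" "[(j, True)]"]
        inj_onD[OF bij_betw_imp_inj_on[OF h(3)], of "[(i, True)]" "[inv_letter (j, True)]"] ij by auto
    then show "i = j" by (auto simp: inv_letter_def)
  qed
  then have surj: "(\<lambda>i. fst (f i)) ` {..<n} = {..<n}" using fn by (intro endo_inj_surj) auto
  have hd_winv: "fst (hd (winv (\<psi> (gen i)))) = fst (f i)" "snd (hd (winv (\<psi> (gen i)))) = (\<not> snd (f i))"
    if "i < n" for i using f[OF that] by (simp_all add: inv_letter_def)
  have good: "fst (f i) = i" if i: "i < n" for i
  proof (rule ccontr)
    assume neq: "fst (f i) \<noteq> i"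
    obtain j where j: "j < n" "fst (f j) = i" using surj i by (metis imageE lessThan_iff)
    then have "i \<noteq> j" using neq by auto
    then obtain \<chi> where \<chi>: "\<chi> \<in> C" "\<chi> (gen i) = \<psi> (gen j)" "\<chi> (gen j) = winv (\<psi> (gen i))"
      "\<And>k. k < n \<Longrightarrow> k \<noteq> i \<Longrightarrow> k \<noteq> j \<Longrightarrow> \<chi> (gen k) = \<psi> (gen k)"
      using ex_swap[OF \<psi>C i j(1)] by blast
    have "length (\<chi> (gen k)) = 1" if "k < n" for k
      using \<chi>(2-4) f i j that by (cases "k = i"; cases "k = j") auto
    then have D: "\<chi> \<in> D" using \<chi>(1) by (simp add: D_def)
    \<comment> \<open>The swap puts index \<open>i\<close> in place. The other affected index
      \<open>j\<close> was already displaced, since its image lay over \<open>i\<close>, so no new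
      displacement arises.\<close>
    have "bad \<chi> \<subseteq> bad \<psi> - {i}"
    proof
      fix k assume "k \<in> bad \<chi>"
      then have k: "k < n" "fst (hd (\<chi> (gen k))) \<noteq> k" by (auto simp: bad_def)
      then have "k \<noteq> i" using \<chi>(2) j f[of j] by auto
      moreover have "fst (f k) \<noteq> k"
        using k \<chi>(4)[OF k(1) \<open>k \<noteq> i\<close>] j \<open>i \<noteq> j\<close> f[OF k(1)] by (cases "k = j") auto
      ultimately show "k \<in> bad \<psi> - {i}" using k(1) by (simp add: bad_def f_def)
    qed
    moreover have "i \<in> bad \<psi>" using neq i by (simp add: bad_def f_def)
    ultimately have "card (bad \<chi>) < card (bad \<psi>)"
      using fin by (intro psubset_card_mono) auto
    then show False using min[OF D] by simp
  qed
  have one_neg: "i = j" if "i \<in> neg \<psi>" "j \<in> neg \<psi>" for i j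
  proof (rule ccontr)
    assume ij: "i \<noteq> j"
    have n: "i < n" "j < n" "\<not> snd (f i)" "\<not> snd (f j)" using that by (auto simp: neg_def f_def)
    obtain \<chi>' where \<chi>': "\<chi>' \<in> C" "\<chi>' (gen i) = \<psi> (gen j)" "\<chi>' (gen j) = winv (\<psi> (gen i))"
      "\<And>k. k < n \<Longrightarrow> k \<noteq> i \<Longrightarrow> k \<noteq> j \<Longrightarrow> \<chi>' (gen k) = \<psi> (gen k)"
      using ex_swap[OF \<psi>C n(1,2) ij] by blast
    \<comment> \<open>Swapping the same pair a second time restores the order and inverts both
      images.\<close>
    obtain \<chi> where \<chi>: "\<chi> \<in> C" "\<chi> (gen i) = \<chi>' (gen j)" "\<chi> (gen j) = winv (\<chi>' (gen i))"
      "\<And>k. k < n \<Longrightarrow> k \<noteq> i \<Longrightarrow> k \<noteq> j \<Longrightarrow> \<chi> (gen k) = \<chi>' (gen k)"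
      using ex_swap[OF \<chi>'(1) n(1,2) ij] by blast
    have vals: "\<chi> (gen k) = (if k = i \<or> k = j then winv (\<psi> (gen k)) else \<psi> (gen k))"
      if "k < n" for k using \<chi>(2-4) \<chi>'(2-4) that by auto
    have D: "\<chi> \<in> D" using \<chi>(1) vals f by (simp add: D_def)
    have "bad \<chi> = {}" "bad \<psi> = {}"
      using vals hd_winv good by (auto simp: bad_def f_def split: if_splits)
    moreover have "neg \<chi> = neg \<psi> - {i, j}"
    proof (rule Set.set_eqI)
      fix k
      show "k \<in> neg \<chi> \<longleftrightarrow> k \<in> neg \<psi> - {i, j}"
        using vals[of k] hd_winv[of k] n by (cases "k = i \<or> k = j") (auto simp: neg_def f_def)
    qed
    then have "card (neg \<chi>) < card (neg \<psi>)"
      using that fin by (intro psubset_card_mono) auto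
    ultimately show False using min(2)[OF D] by simp
  qed
  \<comment> \<open>With nothing displaced, the induced matrix is diagonal with entries
    \<open>s\<close>.\<close>
  define s :: "nat \<Rightarrow> int" where "s i = (if i \<in> neg \<psi> then - 1 else 1)" for i
  have mat: "induced_mat n \<psi> $$ (i, j) = (if i = j then s j else 0)" if "i < n" "j < n" for i j
  proof -
    have "j \<notin> neg \<psi> \<longleftrightarrow> snd (f j)" using that by (simp add: neg_def f_def)
    then have "\<psi> (gen j) = [(j, j \<notin> neg \<psi>)]"
      using f[OF that(2)] good[OF that(2)] by (simp add: prod_eq_iff)
    then show ?thesis using that
      by (auto simp: induced_mat_def mat_of_cols_index abelianization_def exponent_sum_def s_def)
  qed
  have "det (induced_mat n \<psi>) = prod_list (diag_mat (induced_mat n \<psi>))"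
    by (intro det_upper_triangular[of _ n]) (auto simp: upper_triangular_def mat)
  also have "diag_mat (induced_mat n \<psi>) = map s [0..<n]"
    by (auto simp: diag_mat_def mat)
  also have "prod_list \<dots> = (\<Prod>i<n. s i)"
    by (simp add: prod.list_conv_set_nth atLeast0LessThan flip: atLeast0LessThan)
  finally have det: "(\<Prod>i<n. s i) = 1" using S by (simp add: carrier_SAut)
  have "neg \<psi> = {}"
  proof (rule ccontr)
    assume "neg \<psi> \<noteq> {}"
    then obtain i where i: "neg \<psi> = {i}" "i < n" using one_neg by (auto simp: neg_def)
    have "(\<Prod>j<n. s j) = (\<Prod>j<n. if j = i then - 1 else 1)" using i by (simp add: s_def)
    also have "\<dots> = - 1" using i(2) by simp
    finally show False using det by simp
  qed
  then have "snd (f i)" if "i < n" for i using that by (auto simp: neg_def f_def)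
  then have "\<psi> (gen i) = gen i" if "i < n" for i
    using f[OF that] good[OF that] that by (simp add: gen_def prod_eq_iff)
  then have "\<psi> = \<one>\<^bsub>SAut n\<^esub>"
    using S group.is_monoid[OF group_SAut[of n]]
    by (intro SAut_eqI[of _ n] monoid.one_closed exI[of _ True])
      (auto simp: SAut_one_apply gen_def)
  then show ?thesis using \<psi>C by simp
qed

end

text \<open>The coset of \<open>\<phi>\<close> is closed under right multiplication by
  transvections, hence contains the identity, which makes \<open>\<phi>\<close> the inverse of an
  element of \<open>H\<close>.\<close>

theorem SAut_generated_by_transvections:
  assumes H: "subgroup H (SAut n)"
    and t: "\<And>m l :: letter. \<lbrakk>fst m < n; fst l < n; fst m \<noteq> fst l\<rbrakk> \<Longrightarrow> transvection n m l \<in> H"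
  shows "H = carrier (SAut n)"
proof -
  interpret S: group "SAut n" by (rule group_SAut)
  interpret H: subgroup H "SAut n" by (rule H)
  have "\<phi> \<in> H" if \<phi>: "\<phi> \<in> carrier (SAut n)" for \<phi>
  proof -
    have "\<one>\<^bsub>SAut n\<^esub> \<in> \<phi> <#\<^bsub>SAut n\<^esub> H"
    proof (rule one_in_closed_set)
      show "\<phi> <#\<^bsub>SAut n\<^esub> H \<subseteq> carrier (SAut n)" "\<phi> <#\<^bsub>SAut n\<^esub> H \<noteq> {}"
        using \<phi> by (auto simp: l_coset_def intro: H.one_closed)
      fix \<psi> and m l :: letter
      assume "\<psi> \<in> \<phi> <#\<^bsub>SAut n\<^esub> H" and ml: "fst m < n" "fst l < n" "fst m \<noteq> fst l"
      then obtain h where h: "h \<in> H" "\<psi> = \<phi> \<otimes>\<^bsub>SAut n\<^esub> h" by (auto simp: l_coset_def)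
      then show "\<psi> \<otimes>\<^bsub>SAut n\<^esub> transvection n m l \<in> \<phi> <#\<^bsub>SAut n\<^esub> H"
        using t[OF ml] \<phi> by (auto simp: l_coset_def S.m_assoc intro!: bexI[of _ "h \<otimes>\<^bsub>SAut n\<^esub> transvection n m l"])
    qed
    then obtain h where h: "h \<in> H" "\<one>\<^bsub>SAut n\<^esub> = \<phi> \<otimes>\<^bsub>SAut n\<^esub> h" by (auto simp: l_coset_def)
    then have "\<phi> = inv\<^bsub>SAut n\<^esub> h" using \<phi> by (metis H.mem_carrier S.inv_equality)
    then show ?thesis using h by simp
  qed
  then show ?thesis using H.subset by blast
qed

section \<open>Matrices satisfying the relations of transvections\<close>

definition transvection_family :: "'i set \<Rightarrow> nat \<Rightarrow> ('i \<Rightarrow> 'i \<Rightarrow> 'k::field mat) \<Rightarrow> bool" where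
  "transvection_family I d A \<longleftrightarrow>
    (\<forall>i\<in>I. \<forall>j\<in>I. i \<noteq> j \<longrightarrow> A i j \<in> carrier_mat d d \<and> det (A i j) \<noteq> 0) \<and>
    (\<forall>i\<in>I. \<forall>j\<in>I. \<forall>k\<in>I. \<forall>l\<in>I. i \<noteq> j \<longrightarrow> k \<noteq> l \<longrightarrow> {i, j} \<inter> {k, l} = {} \<longrightarrow>
       A i j * A k l = A k l * A i j) \<and>
    (\<forall>i\<in>I. \<forall>j\<in>I. \<forall>k\<in>I. i \<noteq> j \<longrightarrow> j \<noteq> k \<longrightarrow> i \<noteq> k \<longrightarrow>
       A j k * A i j = A i j * A j k * A i k)"

lemma transvection_familyD:
  assumes "transvection_family I d A"
  shows "\<And>i j. i \<in> I \<Longrightarrow> j \<in> I \<Longrightarrow> i \<noteq> j \<Longrightarrow> A i j \<in> carrier_mat d d"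
    and "\<And>i j. i \<in> I \<Longrightarrow> j \<in> I \<Longrightarrow> i \<noteq> j \<Longrightarrow> det (A i j) \<noteq> 0"
    and "\<And>i j k l. \<lbrakk>i \<in> I; j \<in> I; k \<in> I; l \<in> I; i \<noteq> j; k \<noteq> l; {i, j} \<inter> {k, l} = {}\<rbrakk> \<Longrightarrow>
           A i j * A k l = A k l * A i j"
    and "\<And>i j k. \<lbrakk>i \<in> I; j \<in> I; k \<in> I; i \<noteq> j; j \<noteq> k; i \<noteq> k\<rbrakk> \<Longrightarrow>
           A j k * A i j = A i j * A j k * A i k"
  using assms unfolding transvection_family_def by blast+

lemma transvection_family_subset:
  assumes A: "transvection_family I d A" and J: "J \<subseteq> I"
  shows "transvection_family J d A"
  unfolding transvection_family_def
  by (intro conjI ballI impI; rule transvection_familyD[OF A]; (erule subsetD[OF J] | assumption))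

lemma mat_mult_left_fixed_imp_one:
  fixes X Y :: "'k::field mat"
  assumes X: "X \<in> carrier_mat d d" "det X \<noteq> 0" and Y: "Y \<in> carrier_mat d d" and eq: "X * Y = X"
  shows "Y = 1\<^sub>m d"
proof -
  obtain Z where Z: "Z \<in> carrier_mat d d" "Z * X = 1\<^sub>m d"
    using det_non_zero_imp_unit[OF X, of "()"] by (auto simp: Units_def ring_mat_def)
  have "Y = (Z * X) * Y" using Z Y by simp
  also have "\<dots> = Z * (X * Y)" by (rule assoc_mult_mat[OF Z(1) X(1) Y])
  also have "\<dots> = 1\<^sub>m d" by (simp add: eq Z)
  finally show ?thesis .
qed

lemma transvection_family_commute_imp_one:
  assumes A: "transvection_family I d A"
    and ijk: "i \<in> I" "j \<in> I" "k \<in> I" "i \<noteq> j" "j \<noteq> k" "i \<noteq> k"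
    and comm: "A i j * A j k = A j k * A i j"
  shows "A i k = 1\<^sub>m d"
proof -
  note D = transvection_familyD[OF A]
  have c: "A i j \<in> carrier_mat d d" "A j k \<in> carrier_mat d d" "A i k \<in> carrier_mat d d"
    and "det (A i j) \<noteq> 0" "det (A j k) \<noteq> 0"
    using D(1,2) ijk by auto
  then have "det (A i j * A j k) \<noteq> 0" by (simp add: det_mult[of _ d])
  moreover have "A i j * A j k * A i k = A i j * A j k"
    using D(4)[OF ijk] comm by simp
  ultimately show ?thesis
    using c mat_mult_left_fixed_imp_one[of "A i j * A j k" d "A i k"] by simp
qed

text \<open>If one factor of the commutator giving \<open>A a c\<close> is trivial, so is
  \<open>A a c\<close>. Triviality spreads from \<open>A k l\<close> to column \<open>l\<close>,
  from there to all rows except \<open>l\<close>, and finally to row \<open>l\<close> through a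
  third index.\<close>

lemma transvection_family_one_imp_one:
  assumes A: "transvection_family I d A" and card: "card I \<ge> 3"
    and kl: "k \<in> I" "l \<in> I" "k \<noteq> l" "A k l = 1\<^sub>m d"
    and ij: "i \<in> I" "j \<in> I" "i \<noteq> j"
  shows "A i j = 1\<^sub>m d"
proof -
  have left: "A a c = 1\<^sub>m d"
    if "a \<in> I" "b \<in> I" "c \<in> I" "a \<noteq> b" "b \<noteq> c" "a \<noteq> c" "A a b = 1\<^sub>m d" for a b c
    using that transvection_family_commute_imp_one[OF A that(1-6)]
      transvection_familyD(1)[OF A that(2,3,5)] by simp
  have right: "A a c = 1\<^sub>m d"
    if "a \<in> I" "b \<in> I" "c \<in> I" "a \<noteq> b" "b \<noteq> c" "a \<noteq> c" "A b c = 1\<^sub>m d" for a b c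
    using that transvection_family_commute_imp_one[OF A that(1-6)]
      transvection_familyD(1)[OF A that(1,2,4)] by simp
  have 1: "A a l = 1\<^sub>m d" if "a \<in> I" "a \<noteq> l" for a
    using that kl right[of a k l] by metis
  have 2: "A a b = 1\<^sub>m d" if "a \<in> I" "a \<noteq> l" "b \<in> I" "b \<noteq> a" for a b
    using that kl 1 left[of a l b] by metis
  show ?thesis
  proof (cases "i = l")
    case True
    have "card {l, j} < card I" using card by (cases "l = j") auto
    then obtain m where "m \<in> I" "m \<noteq> l" "m \<noteq> j"
      by (metis card_mono finite.emptyI finite.insertI insertCI leD subsetI)
    then show ?thesis using right[of l m j] 2[of m j] ij True by auto
  qed (use 2 ij in auto)
qed

text \<open>Row reducing \<open>N\<close> by \<open>P\<close> puts the image of \<open>N\<close> in the span of the first \<open>k\<close> basis vectors,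
  and matrices commuting with \<open>N\<close> preserve that image.\<close>

lemma commutant_block_triangular:
  fixes N :: "'k::field mat"
  assumes N: "N \<in> carrier_mat d d" "N \<noteq> 0\<^sub>m d d" "det N = 0"
  shows "\<exists>P\<in>carrier_mat d d. \<exists>Q\<in>carrier_mat d d. \<exists>k. P * Q = 1\<^sub>m d \<and> Q * P = 1\<^sub>m d \<and> 0 < k \<and> k < d \<and>
    (\<forall>X\<in>carrier_mat d d. X * N = N * X \<longrightarrow> (\<forall>i j. k \<le> i \<longrightarrow> i < d \<longrightarrow> j < k \<longrightarrow> (P * X * Q) $$ (i, j) = 0))"
proof -
  define C where "C = gauss_jordan_single N"
  note gj = gauss_jordan_single[OF N(1) C_def[symmetric]]
  have C: "C \<in> carrier_mat d d" and ech: "row_echelon_form C" using gj(2,3) by auto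
  obtain P Q where P: "P \<in> carrier_mat d d" and Q: "Q \<in> carrier_mat d d"
    and PQ: "P * Q = 1\<^sub>m d" "Q * P = 1\<^sub>m d" and CP: "C = P * N"
    using gj(4) by blast
  obtain f where f: "pivot_fun C f d"
    using ech C by (auto simp: row_echelon_form_def)
  have dC: "dim_row C = d" using C by simp
  note pf = pivot_funD[OF dC f]
  \<comment> \<open>The pivot position of a zero row is \<open>d\<close>, and zero rows come last;
    so \<open>k\<close> counts the nonzero rows of \<open>C\<close>, which is the rank of
    \<open>N\<close>.\<close>
  define k where "k = (LEAST i. d \<le> i \<or> f i = d)"
  have low: "i < d \<and> f i < d" if "i < k" for i
    using not_less_Least[OF that[unfolded k_def]] pf(1)[of i] by force
  have kk: "d \<le> k \<or> f k = d"
    unfolding k_def by (rule LeastI[of _ d]) simp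
  have high: "f i = d" if "k \<le> i" "i < d" for i
    using that
  proof (induction i rule: dec_induct)
    case base then show ?case using kk by auto
  next
    case (step i)
    then show ?case using pf(1,3)[of i] pf(1)[of "Suc i"] by fastforce
  qed
  have zero: "C $$ (i, j) = 0" if "k \<le> i" "i < d" "j < d" for i j
    using high[OF that(1,2)] pf(2)[OF that(2), of j] that by simp
  have "N = Q * C"
    using assoc_mult_mat[OF Q P N(1)] PQ N(1) CP by simp
  then have "C \<noteq> 0\<^sub>m d d" using N(2) Q by auto
  then have k0: "0 < k"
    using zero C by (metis (no_types, lifting) carrier_matD eq_matI index_zero_mat le0 neq0_conv)
  have "det C = 0" using CP P N by (simp add: det_mult[of _ d])
  then have "C \<noteq> 1\<^sub>m d" by auto
  then have d0: "0 < d" and last: "row C (d - 1) = 0\<^sub>v d"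
    using row_echelon_form_imp_1_or_0_row[OF C ech] by auto
  have "f (d - 1) = d"
    using pivot_fun_zero_row_iff[OF f C, of "d - 1"] d0 last by simp
  then have "\<not> d - 1 < k" using low[of "d - 1"] by auto
  then have kd: "k < d" using d0 by simp
  have "(P * X * Q) $$ (i, j) = 0"
    if X: "X \<in> carrier_mat d d" "X * N = N * X" and ij: "k \<le> i" "i < d" "j < k" for X i j
  proof -
    define Y where "Y = P * X * Q"
    have Y: "Y \<in> carrier_mat d d" using P Q X by (simp add: Y_def)
    \<comment> \<open>Aim: \<open>Y * C = C * X\<close>. The rows of the right side from
      \<open>k\<close> on vanish with those of \<open>C\<close>.\<close>
    have "Y * C = P * X * (Q * (P * N))"
      unfolding Y_def CP using P Q X N by (intro assoc_mult_mat[of _ d d _ d _ d]) auto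
    also have "Q * (P * N) = N"
      using assoc_mult_mat[OF Q P N(1)] PQ N(1) by simp
    also have "P * X * N = P * (N * X)"
      using assoc_mult_mat[OF P X(1) N(1)] X(2) by simp
    also have "\<dots> = C * X" using assoc_mult_mat[OF P N(1) X(1)] CP by simp
    finally have eq: "Y * C = C * X" .
    have j: "j < d" "f j < d" using low[OF ij(3)] by auto
    \<comment> \<open>Column \<open>f j\<close> of \<open>C\<close> is a pivot column, hence a unit
      vector, so this entry of the product isolates \<open>Y $$ (i, j)\<close>.\<close>
    have "(Y * C) $$ (i, f j) = (\<Sum>m = 0..<d. Y $$ (i, m) * C $$ (m, f j))"
      using Y C ij j by (simp add: scalar_prod_def)
    also have "\<dots> = (\<Sum>m = 0..<d. if m = j then Y $$ (i, j) else 0)"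
      using pf(4,5) j by (intro sum.cong) auto
    also have "\<dots> = Y $$ (i, j)" using j by simp
    also have "(Y * C) $$ (i, f j) = (\<Sum>m = 0..<d. C $$ (i, m) * X $$ (m, f j))"
      using eq X C ij j by (simp add: scalar_prod_def)
    also have "\<dots> = 0" using zero ij by simp
    finally show ?thesis unfolding Y_def by simp
  qed
  then show ?thesis using P Q PQ k0 kd by blast
qed

lemma transvection_family_conj:
  fixes A :: "'i \<Rightarrow> 'i \<Rightarrow> 'k::field mat"
  assumes A: "transvection_family I d A"
    and P: "P \<in> carrier_mat d d" and Q: "Q \<in> carrier_mat d d"
    and PQ: "P * Q = 1\<^sub>m d" "Q * P = 1\<^sub>m d"
  shows "transvection_family I d (\<lambda>i j. P * A i j * Q)"
proof -
  note D = transvection_familyD[OF A]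
  have mult: "P * X * Q * (P * Y * Q) = P * (X * Y) * Q"
    if "X \<in> carrier_mat d d" "Y \<in> carrier_mat d d" for X Y
  proof -
    have "P * X * Q * (P * Y * Q) = P * X * ((Q * P) * (Y * Q))"
      using that P Q by (simp add: assoc_mult_mat[of _ d d _ d _ d])
    also have "\<dots> = P * (X * Y) * Q"
      using that P Q PQ by (simp add: assoc_mult_mat[of _ d d _ d _ d])
    finally show ?thesis .
  qed
  have "det P * det Q = 1" using PQ(1) det_mult[OF P Q] by simp
  then have "det P \<noteq> 0" "det Q \<noteq> 0" by auto
  then have "P * A i j * Q \<in> carrier_mat d d \<and> det (P * A i j * Q) \<noteq> 0"
    if "i \<in> I" "j \<in> I" "i \<noteq> j" for i j
    using D(1,2)[OF that] P Q by (simp add: det_mult[of _ d])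
  moreover have "P * A i j * Q * (P * A k l * Q) = P * A k l * Q * (P * A i j * Q)"
    if "i \<in> I" "j \<in> I" "k \<in> I" "l \<in> I" "i \<noteq> j" "k \<noteq> l" "{i, j} \<inter> {k, l} = {}" for i j k l
    using that D(3)[OF that] by (simp add: mult D(1))
  moreover have "P * A j k * Q * (P * A i j * Q) = P * A i j * Q * (P * A j k * Q) * (P * A i k * Q)"
    if "i \<in> I" "j \<in> I" "k \<in> I" "i \<noteq> j" "j \<noteq> k" "i \<noteq> k" for i j k
    using that D(4)[OF that] mult[of "A i j * A j k" "A i k"] D(1)
      mult_carrier_mat[OF D(1)[of i j] D(1)[of j k]] by (simp add: mult)
  ultimately show ?thesis
    unfolding transvection_family_def by blast
qed

text \<open>Taking diagonal blocks is multiplicative on block triangular matrices, so the relations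
  descend to the invariant subspace and to the quotient. The determinant factors over the blocks, so
  neither block is singular.\<close>

lemma transvection_family_block:
  fixes A :: "'i \<Rightarrow> 'i \<Rightarrow> 'k::field mat"
  assumes A: "transvection_family I d A" and kd: "k \<le> d"
    and zero: "\<And>a b i j. \<lbrakk>a \<in> I; b \<in> I; a \<noteq> b; k \<le> i; i < d; j < k\<rbrakk> \<Longrightarrow> A a b $$ (i, j) = 0"
  shows "\<exists>B C D. transvection_family I k B \<and> transvection_family I (d - k) D \<and>
    (\<forall>a\<in>I. \<forall>b\<in>I. a \<noteq> b \<longrightarrow> C a b \<in> carrier_mat k (d - k) \<and>
       A a b = four_block_mat (B a b) (C a b) (0\<^sub>m (d - k) k) (D a b))"
proof -
  note F = transvection_familyD[OF A]
  define B where "B a b = mat k k (\<lambda>ij. A a b $$ ij)" for a b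
  define C where "C a b = mat k (d - k) (\<lambda>(i, j). A a b $$ (i, j + k))" for a b
  define D where "D a b = mat (d - k) (d - k) (\<lambda>(i, j). A a b $$ (i + k, j + k))" for a b
  have c: "B a b \<in> carrier_mat k k" "C a b \<in> carrier_mat k (d - k)"
    "D a b \<in> carrier_mat (d - k) (d - k)" for a b
    by (simp_all add: B_def C_def D_def)
  let ?M = "\<lambda>a b. four_block_mat (B a b) (C a b) (0\<^sub>m (d - k) k) (D a b)"
  have M: "A a b = ?M a b" if "a \<in> I" "b \<in> I" "a \<noteq> b" for a b
    using F(1)[OF that] zero[OF that] kd
    by (intro eq_matI) (auto simp: B_def C_def D_def)
  have det: "det (A a b) = det (B a b) * det (D a b)" if "a \<in> I" "b \<in> I" "a \<noteq> b" for a b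
    unfolding M[OF that] by (rule det_four_block_mat_lower_left_zero[OF c(1,2) refl c(3)])
  \<comment> \<open>The diagonal blocks are recovered as submatrices, so that an equation of block
    matrices can be split into equations of blocks.\<close>
  have corner: "mat k k (\<lambda>ij. four_block_mat X Y Z W $$ ij) = X"
    "mat (d - k) (d - k) (\<lambda>(i, j). four_block_mat X Y Z W $$ (i + k, j + k)) = W"
    if "X \<in> carrier_mat k k" "W \<in> carrier_mat (d - k) (d - k)" for X Y Z W :: "'k mat"
    using that by (auto intro!: eq_matI)
  have prod: "four_block_mat X Y (0\<^sub>m (d - k) k) W * four_block_mat X' Y' (0\<^sub>m (d - k) k) W' =
      four_block_mat (X * X') (X * Y' + Y * W') (0\<^sub>m (d - k) k) (W * W')"
    if "X \<in> carrier_mat k k" "W \<in> carrier_mat (d - k) (d - k)" "Y \<in> carrier_mat k (d - k)"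
       "X' \<in> carrier_mat k k" "W' \<in> carrier_mat (d - k) (d - k)" "Y' \<in> carrier_mat k (d - k)"
    for X Y W X' Y' W' :: "'k mat"
    using that by (subst mult_four_block_mat[of _ k k _ "d - k" _ "d - k" _ _ k _ "d - k"]) auto
  have inj: "X = X' \<and> W = W'"
    if "four_block_mat X Y (0\<^sub>m (d - k) k) W = four_block_mat X' Y' (0\<^sub>m (d - k) k) W'"
       "X \<in> carrier_mat k k" "W \<in> carrier_mat (d - k) (d - k)"
       "X' \<in> carrier_mat k k" "W' \<in> carrier_mat (d - k) (d - k)"
    for X Y W X' Y' W' :: "'k mat"
    using corner(1)[OF that(2,3), of Y "0\<^sub>m (d - k) k"] corner(2)[OF that(2,3), of Y "0\<^sub>m (d - k) k"]
      corner(1)[OF that(4,5), of Y' "0\<^sub>m (d - k) k"] corner(2)[OF that(4,5), of Y' "0\<^sub>m (d - k) k"]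
      that(1) by metis
  have comm: "B a b * B a' b' = B a' b' * B a b \<and> D a b * D a' b' = D a' b' * D a b"
    if "a \<in> I" "b \<in> I" "a \<noteq> b" "a' \<in> I" "b' \<in> I" "a' \<noteq> b'" "{a, b} \<inter> {a', b'} = {}" for a b a' b'
    using F(3)[OF that(1,2,4,5,3,6,7)] c unfolding M[OF that(1-3)] M[OF that(4-6)]
    by (intro inj) (auto simp: prod intro: mult_carrier_mat[OF c(1) c(1)] mult_carrier_mat[OF c(3) c(3)])
  have rel: "B j l * B i j = B i j * B j l * B i l \<and> D j l * D i j = D i j * D j l * D i l"
    if "i \<in> I" "j \<in> I" "l \<in> I" "i \<noteq> j" "j \<noteq> l" "i \<noteq> l" for i j l
  proof -
    have "?M j l * ?M i j = ?M i j * ?M j l * ?M i l"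
      using F(4)[OF that] M that by simp
    moreover have "B i j * C j l + C i j * D j l \<in> carrier_mat k (d - k)"
      by (intro add_carrier_mat mult_carrier_mat[OF c(2) c(3)])
    ultimately show ?thesis
      using c mult_carrier_mat[OF c(1) c(1)] mult_carrier_mat[OF c(3) c(3)]
        mult_carrier_mat[OF mult_carrier_mat[OF c(1) c(1)] c(1)]
        mult_carrier_mat[OF mult_carrier_mat[OF c(3) c(3)] c(3)]
      by (intro inj) (auto simp: prod simp del: assoc_mult_mat)
  qed
  have "transvection_family I k B" "transvection_family I (d - k) D"
    unfolding transvection_family_def using c comm rel det F(2) by auto
  then show ?thesis using c M by blast
qed

text \<open>Induction on \<open>d\<close> along the bound \<open>2 * d + 1\<close>: passing to a
  proper block costs two indices and at least one dimension.\<close>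

theorem transvection_family_trivial:
  fixes A :: "'i \<Rightarrow> 'i \<Rightarrow> 'k::alg_closed_field mat"
  assumes "transvection_family I d A" and "finite I" and "card I \<ge> 2 * d + 1"
    and "i \<in> I" "j \<in> I" "i \<noteq> j"
  shows "A i j = 1\<^sub>m d"
  using assms
proof (induction d arbitrary: I A i j rule: less_induct)
  case (less d)
  note A = less.prems(1) and fin = less.prems(2) and card = less.prems(3)
  note F = transvection_familyD[OF A]
  have T: "A i j \<in> carrier_mat d d" using F(1) less.prems by auto
  show ?case
  proof (cases "d = 0")
    case True
    then show ?thesis using T by auto
  next
    case False
    then have card3: "card I \<ge> 3" using card by simp
    have "degree (char_poly (A i j)) = d" "char_poly (A i j) \<noteq> 0"
      using degree_monic_char_poly[OF T] by auto
    then obtain \<mu> where "poly (char_poly (A i j)) \<mu> = 0"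
      using alg_closed_imp_poly_has_root[of "char_poly (A i j)"] False by auto
    then have ev: "eigenvalue (A i j) \<mu>"
      using eigenvalue_root_char_poly[OF T] by simp
    define N where "N = char_matrix (A i j) \<mu>"
    have N: "N \<in> carrier_mat d d" "det N = 0"
      using eigenvalue_det[OF T] ev T by (auto simp: N_def)
    have Ndef: "N = A i j + (- \<mu>) \<cdot>\<^sub>m 1\<^sub>m d"
      using T by (auto simp: N_def char_matrix_def)
    have commN: "X * N = N * X" if "X \<in> carrier_mat d d" "X * A i j = A i j * X" for X
    proof -
      have "X * N = X * A i j + (- \<mu>) \<cdot>\<^sub>m X"
        unfolding Ndef using that(1) T by (subst mult_add_distrib_mat[of _ d d _ d]) auto
      moreover have "N * X = A i j * X + (- \<mu>) \<cdot>\<^sub>m X"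
        unfolding Ndef using that(1) T by (subst add_mult_distrib_mat[of _ d d _ _ d]) auto
      ultimately show ?thesis using that(2) by simp
    qed
    show ?thesis
    proof (cases "N = 0\<^sub>m d d")
      case True
      have Aij: "A i j = \<mu> \<cdot>\<^sub>m 1\<^sub>m d"
      proof (rule eq_matI)
        fix r c assume rc: "r < dim_row (\<mu> \<cdot>\<^sub>m 1\<^sub>m d)" "c < dim_col (\<mu> \<cdot>\<^sub>m 1\<^sub>m d :: 'k mat)"
        then have "N $$ (r, c) = 0" using True by simp
        then show "A i j $$ (r, c) = (\<mu> \<cdot>\<^sub>m 1\<^sub>m d) $$ (r, c)"
          using rc T unfolding Ndef by (auto split: if_splits)
      qed (use T in auto)
      have "card {i, j} < card I" using card3 less.prems by auto
      then obtain m where m: "m \<in> I" "m \<noteq> i" "m \<noteq> j"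
        by (metis card_mono finite.emptyI finite.insertI insertCI leD subsetI)
      have "A i j * A j m = A j m * A i j"
        unfolding Aij using F(1)[of j m] m less.prems by auto
      then have "A i m = 1\<^sub>m d"
        using transvection_family_commute_imp_one[OF A, of i j m] m less.prems by auto
      then show ?thesis
        using transvection_family_one_imp_one[OF A card3, of i m i j] m less.prems by auto
    next
      case False
      obtain P Q k where P: "P \<in> carrier_mat d d" and Q: "Q \<in> carrier_mat d d"
        and PQ: "P * Q = 1\<^sub>m d" "Q * P = 1\<^sub>m d" and k: "0 < k" "k < d"
        and blk: "\<And>X r c. \<lbrakk>X \<in> carrier_mat d d; X * N = N * X; k \<le> r; r < d; c < k\<rbrakk> \<Longrightarrow>
          (P * X * Q) $$ (r, c) = 0"
        using commutant_block_triangular[OF N(1) False N(2)] by blast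
      define J where "J = I - {i, j}"
      have "card J = card I - 2" using fin less.prems by (simp add: J_def card_Diff_subset)
      \<comment> \<open>As \<open>0 < k < d\<close> forces \<open>d \<ge> 2\<close>, this bound also
        leaves three indices in \<open>J\<close>, enough for a commutator.\<close>
      then have cJ: "card J \<ge> 2 * (d - 1) + 1" "finite J" using card fin k by (auto simp: J_def)
      have fJ: "transvection_family J d A"
        using transvection_family_subset[OF A] by (auto simp: J_def)
      define A' where "A' a b = P * A a b * Q" for a b
      have fJ': "transvection_family J d A'"
        unfolding A'_def by (rule transvection_family_conj[OF fJ P Q PQ])
      have zero: "A' a b $$ (r, c) = 0"
        if "a \<in> J" "b \<in> J" "a \<noteq> b" "k \<le> r" "r < d" "c < k" for a b r c
        unfolding A'_def
      proof (rule blk[OF _ commN])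
        show "A a b \<in> carrier_mat d d" using F(1) that by (auto simp: J_def)
        then show "A a b \<in> carrier_mat d d" .
        show "A a b * A i j = A i j * A a b"
          using that less.prems by (intro F(3)) (auto simp: J_def)
      qed (use that in auto)
      obtain B C D where B: "transvection_family J k B" and D: "transvection_family J (d - k) D"
        and C: "\<And>a b. a \<in> J \<Longrightarrow> b \<in> J \<Longrightarrow> a \<noteq> b \<Longrightarrow> C a b \<in> carrier_mat k (d - k) \<and>
          A' a b = four_block_mat (B a b) (C a b) (0\<^sub>m (d - k) k) (D a b)"
        using transvection_family_block[OF fJ' less_imp_le[OF k(2)]] zero by blast
      have form: "A' a b = four_block_mat (1\<^sub>m k) (C a b) (0\<^sub>m (d - k) k) (1\<^sub>m (d - k))"
        if "a \<in> J" "b \<in> J" "a \<noteq> b" for a b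
        using C[OF that] less.IH[OF k(2) B cJ(2) _ that] less.IH[OF _ D cJ(2) _ that] k cJ(1)
        by auto
      have "card J \<ge> 3" using cJ k by linarith
      then obtain S where "S \<subseteq> J" "card S = 3" by (meson obtain_subset_with_card_n)
      then obtain a b c where abc: "a \<in> J" "b \<in> J" "c \<in> J" "a \<noteq> b" "b \<noteq> c" "a \<noteq> c"
        unfolding card_3_iff by blast
      have "A' a b * A' b c = A' b c * A' a b"
      proof -
        \<comment> \<open>Block unipotent matrices multiply by adding their upper right blocks,
          hence commute.\<close>
        have *: "four_block_mat (1\<^sub>m k) Y (0\<^sub>m (d - k) k) (1\<^sub>m (d - k)) *
            four_block_mat (1\<^sub>m k) Y' (0\<^sub>m (d - k) k) (1\<^sub>m (d - k)) =
            four_block_mat (1\<^sub>m k) (Y' + Y) (0\<^sub>m (d - k) k) (1\<^sub>m (d - k))"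
          if "Y \<in> carrier_mat k (d - k)" "Y' \<in> carrier_mat k (d - k)" for Y Y' :: "'k mat"
          using that
          by (subst mult_four_block_mat[of _ k k _ "d - k" _ "d - k" _ _ k _ "d - k"]) auto
        show ?thesis
          unfolding form[OF abc(1,2,4)] form[OF abc(2,3,5)]
          using C[OF abc(1,2,4)] C[OF abc(2,3,5)] by (simp add: * comm_add_mat[of _ k "d - k"])
      qed
      then have one: "A' a c = 1\<^sub>m d"
        by (rule transvection_family_commute_imp_one[OF fJ' abc])
      have Aac: "A a c \<in> carrier_mat d d" by (rule transvection_familyD(1)[OF fJ abc(1,3,6)])
      have "A a c = Q * A' a c * P"
      proof -
        have "Q * A' a c * P = (Q * P) * A a c * (Q * P)"
          unfolding A'_def using P Q Aac by (simp add: assoc_mult_mat[of _ d d _ d _ d])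
        then show ?thesis using PQ Aac by simp
      qed
      then have "A a c = 1\<^sub>m d" using one PQ Q by simp
      then show ?thesis
        using transvection_family_one_imp_one[OF A card3, of a c i j] abc less.prems
        by (auto simp: J_def)
    qed
  qed
qed

section \<open>Triviality of low-dimensional representations\<close>

lemma transvection_commute:
  assumes ml: "fst m < n" "fst l < n" "fst m \<noteq> fst l"
    and ml': "fst m' < n" "fst l' < n" "fst m' \<noteq> fst l'"
    and disj: "{fst m, fst l} \<inter> {fst m', fst l'} = {}"
  shows "transvection n m l \<otimes>\<^bsub>SAut n\<^esub> transvection n m' l' =
    transvection n m' l' \<otimes>\<^bsub>SAut n\<^esub> transvection n m l"
proof (rule SAut_eqI)
  interpret S: group "SAut n" by (rule group_SAut)
  note t = transvection_in_SAut[OF ml] and t' = transvection_in_SAut[OF ml']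
  show "transvection n m l \<otimes>\<^bsub>SAut n\<^esub> transvection n m' l' \<in> carrier (SAut n)"
    "transvection n m' l' \<otimes>\<^bsub>SAut n\<^esub> transvection n m l \<in> carrier (SAut n)"
    using t t' by simp_all
  note M = SAut_mult_transvection[OF t ml'] SAut_mult_transvection[OF t' ml]
  note T = transvection_same[OF ml] transvection_same[OF ml']
    transvection_other[OF ml] transvection_other[OF ml']
  fix i assume i: "i < n"
  have cancel: "m \<noteq> inv_letter l" "m' \<noteq> inv_letter l'" using ml ml' by auto
  \<comment> \<open>The sign picks the letter \<open>m\<close> or \<open>m'\<close> itself, where
    the transvection prepends a letter.\<close>
  define b where "b = (if i = fst m then snd m else if i = fst m' then snd m' else True)"
  show "\<exists>b. (transvection n m l \<otimes>\<^bsub>SAut n\<^esub> transvection n m' l') [(i, b)] =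
      (transvection n m' l' \<otimes>\<^bsub>SAut n\<^esub> transvection n m l) [(i, b)]"
  proof (rule exI[of _ b])
    consider "i = fst m" | "i \<noteq> fst m" "i = fst m'" | "i \<noteq> fst m" "i \<noteq> fst m'" by blast
    then show "(transvection n m l \<otimes>\<^bsub>SAut n\<^esub> transvection n m' l') [(i, b)] =
      (transvection n m' l' \<otimes>\<^bsub>SAut n\<^esub> transvection n m l) [(i, b)]"
    proof cases
      case 1
      then have "(i, b) = m" by (simp add: b_def)
      then show ?thesis using ml ml' disj cancel by (simp add: M T)
    next
      case 2
      then have "(i, b) = m'" by (simp add: b_def)
      then show ?thesis using ml ml' disj cancel by (simp add: M T)
    next
      case 3
      then show ?thesis using i by (simp add: M T)
    qed
  qed
qed

text \<open>With a common sign \<open>s\<close> all three maps act by prepending. Both sides send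
  the letter over \<open>i\<close> to the word over k, j, i, and the letter over \<open>j\<close> to
  the word over k, j.\<close>

lemma transvection_commutator:
  assumes ijk: "i < n" "j < n" "k < n" "i \<noteq> j" "j \<noteq> k" "i \<noteq> k"
  shows "transvection n (j, s) (k, s) \<otimes>\<^bsub>SAut n\<^esub> transvection n (i, s) (j, s) =
    transvection n (i, s) (j, s) \<otimes>\<^bsub>SAut n\<^esub> transvection n (j, s) (k, s) \<otimes>\<^bsub>SAut n\<^esub>
      transvection n (i, s) (k, s)"
proof (rule SAut_eqI)
  interpret S: group "SAut n" by (rule group_SAut)
  let ?t = "\<lambda>i j. transvection n (i, s) (j, s)"
  have t: "?t a b \<in> carrier (SAut n)" if "a < n" "b < n" "a \<noteq> b" for a b
    using that by (intro transvection_in_SAut) auto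
  show c: "?t j k \<otimes>\<^bsub>SAut n\<^esub> ?t i j \<in> carrier (SAut n)"
    "?t i j \<otimes>\<^bsub>SAut n\<^esub> ?t j k \<otimes>\<^bsub>SAut n\<^esub> ?t i k \<in> carrier (SAut n)"
    using t ijk by simp_all
  have same: "(\<psi> \<otimes>\<^bsub>SAut n\<^esub> ?t a b) [(a, s)] = \<psi> [(b, s)] \<odot> \<psi> [(a, s)]"
    if "\<psi> \<in> carrier (SAut n)" "a < n" "b < n" "a \<noteq> b" for \<psi> a b
    using SAut_mult_transvection(1)[OF that(1), of "(a, s)" "(b, s)"] that by simp
  have other: "(\<psi> \<otimes>\<^bsub>SAut n\<^esub> ?t a b) [(x, s)] = \<psi> [(x, s)]"
    if "\<psi> \<in> carrier (SAut n)" "a < n" "b < n" "a \<noteq> b" "x < n" "x \<noteq> a" for \<psi> a b x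
    using SAut_mult_transvection(2)[OF that(1), of "(a, s)" "(b, s)" "(x, s)"] that by simp
  have T: "?t a b [(a, s)] = [(b, s), (a, s)]" "x < n \<Longrightarrow> x \<noteq> a \<Longrightarrow> ?t a b [(x, s)] = [(x, s)]"
    if "a < n" "b < n" "a \<noteq> b" for a b x
    using that by (simp_all add: transvection_same transvection_other)
  fix x assume x: "x < n"
  show "\<exists>b. (?t j k \<otimes>\<^bsub>SAut n\<^esub> ?t i j) [(x, b)] =
      (?t i j \<otimes>\<^bsub>SAut n\<^esub> ?t j k \<otimes>\<^bsub>SAut n\<^esub> ?t i k) [(x, b)]"
    using ijk x
    by (intro exI[of _ s], cases "x = i"; cases "x = j")
      (simp_all add: same other T t inv_letter_def)
qed

text \<open>For each sign \<open>s\<close> the transvections with both letters of sign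
  \<open>s\<close> form a transvection family, so they lie in the kernel. Those of mixed sign are
  inverses of such, and together they generate.\<close>

theorem SAut_hom_SL_trivial:
  fixes \<rho> :: "(letter list \<Rightarrow> letter list) \<Rightarrow> 'k::alg_closed_field mat"
  assumes \<rho>: "\<rho> \<in> hom (SAut n) (SL d)" and nd: "n \<ge> 2 * d + 1" and \<phi>: "\<phi> \<in> carrier (SAut n)"
  shows "\<rho> \<phi> = 1\<^sub>m d"
proof -
  interpret S: group "SAut n" by (rule group_SAut)
  have car: "\<rho> g \<in> carrier_mat d d" "det (\<rho> g) = 1" if "g \<in> carrier (SAut n)" for g
    using hom_in_carrier[OF \<rho> that] by (auto simp: SL_def)
  have mult: "\<rho> (g \<otimes>\<^bsub>SAut n\<^esub> h) = \<rho> g * \<rho> h" if "g \<in> carrier (SAut n)" "h \<in> carrier (SAut n)" for g h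
    using hom_mult[OF \<rho> that] by (simp add: SL_def)
  \<comment> \<open>Membership in \<open>hom\<close> only states multiplicativity; the image of the
    identity is idempotent and invertible, hence the identity matrix.\<close>
  have one: "\<rho> \<one>\<^bsub>SAut n\<^esub> = 1\<^sub>m d"
    using mult[of "\<one>\<^bsub>SAut n\<^esub>" "\<one>\<^bsub>SAut n\<^esub>"] car[of "\<one>\<^bsub>SAut n\<^esub>"]
    by (intro mat_mult_left_fixed_imp_one[of "\<rho> \<one>\<^bsub>SAut n\<^esub>"]) auto
  let ?H = "{g \<in> carrier (SAut n). \<rho> g = 1\<^sub>m d}"
  have "subgroup ?H (SAut n)"
  proof (rule S.subgroupI)
    fix g assume g: "g \<in> ?H"
    then have "\<rho> (inv\<^bsub>SAut n\<^esub> g) = \<rho> (inv\<^bsub>SAut n\<^esub> g \<otimes>\<^bsub>SAut n\<^esub> g)"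
      using mult[of "inv\<^bsub>SAut n\<^esub> g" g] right_mult_one_mat[OF car(1)[of "inv\<^bsub>SAut n\<^esub> g"]] by simp
    then show "inv\<^bsub>SAut n\<^esub> g \<in> ?H" using g one by simp
  qed (use one mult in auto)
  moreover have "transvection n m l \<in> ?H" if ml: "fst m < n" "fst l < n" "fst m \<noteq> fst l" for m l
  proof -
    have t: "transvection n (i, s) (j, s) \<in> carrier (SAut n)" if "i < n" "j < n" "i \<noteq> j" for i j s
      using that by (intro transvection_in_SAut) auto
    have triv: "\<rho> (transvection n (i, s) (j, s)) = 1\<^sub>m d" if ij: "i < n" "j < n" "i \<noteq> j" for i j s
    proof -
      have "transvection_family {..<n} d (\<lambda>i j. \<rho> (transvection n (i, s) (j, s)))"
        unfolding transvection_family_def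
      proof (intro conjI ballI impI)
        fix i j k l assume "i \<in> {..<n}" "j \<in> {..<n}" "k \<in> {..<n}" "l \<in> {..<n}"
          "i \<noteq> j" "k \<noteq> l" "{i, j} \<inter> {k, l} = {}"
        then show "\<rho> (transvection n (i, s) (j, s)) * \<rho> (transvection n (k, s) (l, s)) =
          \<rho> (transvection n (k, s) (l, s)) * \<rho> (transvection n (i, s) (j, s))"
          using transvection_commute[of "(i, s)" n "(j, s)" "(k, s)" "(l, s)"]
          by (simp add: t flip: mult)
      next
        fix i j k assume "i \<in> {..<n}" "j \<in> {..<n}" "k \<in> {..<n}" "i \<noteq> j" "j \<noteq> k" "i \<noteq> k"
        then show "\<rho> (transvection n (j, s) (k, s)) * \<rho> (transvection n (i, s) (j, s)) =
          \<rho> (transvection n (i, s) (j, s)) * \<rho> (transvection n (j, s) (k, s)) *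
            \<rho> (transvection n (i, s) (k, s))"
          using transvection_commutator[of i n j k s] by (simp add: t flip: mult)
      qed (use car t in auto)
      then show ?thesis using transvection_family_trivial[of "{..<n}" d _ i j] nd ij by simp
    qed
    have tml: "transvection n m l \<in> carrier (SAut n)" by (rule transvection_in_SAut[OF ml])
    have "\<rho> (transvection n m l) = 1\<^sub>m d"
    proof (cases "snd m = snd l")
      case True
      then have "l = (fst l, snd m)" by (simp add: prod_eq_iff)
      then show ?thesis using triv[of "fst m" "fst l" "snd m"] ml by simp
    next
      case False
      then have il: "inv_letter l = (fst l, snd m)" by (auto simp: inv_letter_def)
      then have ti: "transvection n m (inv_letter l) \<in> carrier (SAut n)"
        and triv': "\<rho> (transvection n m (inv_letter l)) = 1\<^sub>m d"
        using triv[of "fst m" "fst l" "snd m"] t[of "fst m" "fst l" "snd m"] ml by simp_all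
      have "transvection n m l \<otimes>\<^bsub>SAut n\<^esub> transvection n m (inv_letter l) = \<one>\<^bsub>SAut n\<^esub>"
        using tml ti transvection_cancel[OF ml]
        by (intro SAut_eqI[of _ n]) (simp_all add: SAut_mult_apply SAut_one_apply)
      then have "\<rho> (transvection n m l) * 1\<^sub>m d = 1\<^sub>m d"
        using mult[OF tml ti] triv' one by simp
      then show ?thesis using car(1)[OF tml] by simp
    qed
    then show ?thesis using tml by simp
  qed
  ultimately have "?H = carrier (SAut n)" by (rule SAut_generated_by_transvections)
  then show ?thesis using \<phi> by blast
qed

text \<open>On the carrier all these representations are trivial, so any two are conjugate and the
  quotient has at most one class.\<close>

theorem corollaryD:
  fixes n d :: nat
  assumes "n \<ge> 5" and "d \<ge> 1" and "d \<le> 2 * ((n - 1) div 4) - 1"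
  shows "finite ((irreps (SAut n) d :: ((letter list \<Rightarrow> letter list) \<Rightarrow> 'k::alg_closed_field mat) set)
                  // conjugacy_rel (SAut n) d)"
proof -
  let ?I = "irreps (SAut n) d :: ((letter list \<Rightarrow> letter list) \<Rightarrow> 'k mat) set"
  \<comment> \<open>From \<open>n \<ge> 5\<close> the quotient \<open>(n - 1) div 4\<close> is
    positive, so the subtraction does not truncate, and
    \<open>2 * d \<le> 4 * ((n - 1) div 4) - 2 \<le> n - 3\<close>.\<close>
  have "n \<ge> 2 * d + 1" using assms by linarith
  then have triv: "\<rho> g = 1\<^sub>m d" if "\<rho> \<in> ?I" "g \<in> carrier (SAut n)" for \<rho> g
    using SAut_hom_SL_trivial[of \<rho> n d g] that by (auto simp: irreps_def)
  \<comment> \<open>Two such functions may differ off the carrier, so they need not be equal; the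
    identity matrix conjugates one to the other.\<close>
  have rel: "(\<rho>, \<sigma>) \<in> conjugacy_rel (SAut n) d" if "\<rho> \<in> ?I" "\<sigma> \<in> ?I" for \<rho> \<sigma>
    using that triv[OF that(1)] triv[OF that(2)]
    by (auto simp: conjugacy_rel_def conjugate_reps_def intro!: bexI[of _ "1\<^sub>m d"])
  have "?I // conjugacy_rel (SAut n) d \<subseteq> {?I}"
    using rel by (auto simp: quotient_def conjugacy_rel_def)
  then show ?thesis by (rule finite_subset) simp
qed

end
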